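(* Let $A,B,C,D$ be complex numbers with $|C|,|D|<1$, and let $N\geq 1$ be an integer. Then $$\int_{U(N)}\frac{\det(1-Au)\det(1-Bu^{-1})}{\det(1-Cu)\det(1-Du^{-1})}\,du = \frac{(1-BC)(1-AD)}{(1-AB)(1-CD)} + (AB)^N \frac{(1-CA^{-1})(1-DB^{-1})}{(1-(AB)^{-1})(1-CD)},$$ where, for values with $AB\in\{0,1\}$, the right-hand side is understood as its continuous extension in $(A,B)\in\mathbb{C}^2$.
   Context: $U(N)$ is the group of $N\times N$ unitary matrices, $du$ is Haar probability measure on it, and $1$ inside a determinant denotes the $N\times N$ identity matrix. *)

theory Defs
  imports "HOL-Probability.Probability" "HOL-Computational_Algebra.Polynomial"
begin

definition unitary_group :: "(complex^'n^'n) set" where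
  "unitary_group =
     {u. u ** map_matrix cnj (transpose u) = mat 1 \<and> map_matrix cnj (transpose u) ** u = mat 1}"

text \<open>Only left translation invariance is demanded, as in the general definition of Haar measure.
  \<open>U(N)\<close> being compact, the normalisation determines the measure, which is then also right
  invariant.\<close>

definition haar_probability :: "(complex^'n^'n) measure \<Rightarrow> bool" where
  "haar_probability M \<longleftrightarrow>
     prob_space M \<and>
     space M = unitary_group \<and>
     sets M = sets (restrict_space borel unitary_group) \<and>
     (\<forall>g\<in>unitary_group. distr M M (\<lambda>u. g ** u) = M)"

definition ratio_rhs_generic ::
    "nat \<Rightarrow> complex \<Rightarrow> complex \<Rightarrow> complex \<Rightarrow> complex \<Rightarrow> complex" where
  "ratio_rhs_generic N A B C D =
     ((1 - B * C) * (1 - A * D)) / ((1 - A * B) * (1 - C * D)) +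
     (A * B) ^ N * (((1 - C * inverse A) * (1 - D * inverse B)) /
                    ((1 - inverse (A * B)) * (1 - C * D)))"

text \<open>The formula above is the intended one only for \<open>A * B \<notin> {0, 1}\<close>, since HOL sets \<open>inverse 0 = 0\<close>
  and \<open>x / 0 = 0\<close>.  Its continuous extension in \<open>(A, B)\<close> to all of \<open>\<complex> \<times> \<complex>\<close> exists and is unique by
  the lemma \<open>ratio_rhs_ex1\<close> below, so the definite description is proper.\<close>

definition is_ratio_rhs_extension ::
    "nat \<Rightarrow> complex \<Rightarrow> complex \<Rightarrow> (complex \<times> complex \<Rightarrow> complex) \<Rightarrow> bool" where
  "is_ratio_rhs_extension N C D R \<longleftrightarrow>
     continuous_on UNIV R \<and>
     (\<forall>A B. A * B \<notin> {0, 1} \<longrightarrow> R (A, B) = ratio_rhs_generic N A B C D)"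

definition ratio_rhs :: "nat \<Rightarrow> complex \<Rightarrow> complex \<Rightarrow> complex \<Rightarrow> complex \<Rightarrow> complex" where
  "ratio_rhs N A B C D = (THE R. is_ratio_rhs_extension N C D R) (A, B)"

lemma ratio_rhs_generic_eq:
  assumes "A * B \<notin> {0, 1}" "C * D \<noteq> 1"
  shows "ratio_rhs_generic N A B C D =
     (1 - B * C) * (1 - A * D) * (\<Sum>k<N. (A * B) ^ k) / (1 - C * D) + (A * B) ^ N"
proof -
  define q where "q = (A * B) ^ N"
  have nz: "A \<noteq> 0" "B \<noteq> 0" "1 - A * B \<noteq> 0" "A * B \<noteq> 1" "1 - C * D \<noteq> 0"
    using assms by auto
  have geo: "(\<Sum>k<N. (A * B) ^ k) = (1 - q) / (1 - A * B)"
    unfolding q_def using nz(4) by (simp add: sum_gp_strict)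
  have "1 - C * inverse A = (A - C) / A" "1 - D * inverse B = (B - D) / B"
    using nz by (simp_all add: field_simps)
  moreover have "1 - inverse (A * B) = - ((1 - A * B) / (A * B))"
    using nz by (simp add: field_simps)
  ultimately have second: "((1 - C * inverse A) * (1 - D * inverse B)) / ((1 - inverse (A * B)) * (1 - C * D))
     = - ((A - C) * (B - D) / ((1 - A * B) * (1 - C * D)))"
    using nz by simp
  have one: "1 = ((1 - B * C) * (1 - A * D) - (A - C) * (B - D)) / ((1 - A * B) * (1 - C * D))"
    using nz by (simp add: eq_divide_eq) (simp add: algebra_simps)
  have "(1 - B * C) * (1 - A * D) * (\<Sum>k<N. (A * B) ^ k) / (1 - C * D) + q =
        (1 - B * C) * (1 - A * D) * (1 - q) / ((1 - A * B) * (1 - C * D)) + q * 1"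
    unfolding geo by simp
  also have "\<dots> = (1 - B * C) * (1 - A * D) * (1 - q) / ((1 - A * B) * (1 - C * D)) +
      q * ((1 - B * C) * (1 - A * D) - (A - C) * (B - D)) / ((1 - A * B) * (1 - C * D))"
    by (subst one) simp
  also have "\<dots> = ((1 - B * C) * (1 - A * D)) / ((1 - A * B) * (1 - C * D)) +
      q * (- ((A - C) * (B - D) / ((1 - A * B) * (1 - C * D))))"
    by (simp add: add_divide_distrib[symmetric] diff_divide_distrib[symmetric] algebra_simps)
  finally show ?thesis
    unfolding ratio_rhs_generic_def second q_def[symmetric] by simp
qed

lemma ratio_rhs_ex1:
  assumes "C * D \<noteq> 1"
  shows "\<exists>!R. is_ratio_rhs_extension N C D R"
proof (rule ex_ex1I)
  let ?R = "\<lambda>p. (1 - snd p * C) * (1 - fst p * D) * (\<Sum>k<N. (fst p * snd p) ^ k) / (1 - C * D)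
                + (fst p * snd p) ^ N"
  have "is_ratio_rhs_extension N C D ?R"
    unfolding is_ratio_rhs_extension_def
    using assms by (auto intro!: continuous_intros simp: ratio_rhs_generic_eq)
  then show "\<exists>R. is_ratio_rhs_extension N C D R" by blast
next
  fix R S
  assume R: "is_ratio_rhs_extension N C D R" and S: "is_ratio_rhs_extension N C D S"
  have "R (a, b) = S (a, b)" for a b
  proof -
    let ?d = "\<lambda>t. R (a + t, b + t) - S (a + t, b + t)"
    let ?bad = "\<lambda>c. {t. poly [:a * b - c, a + b, 1:] t = 0}"
    have "finite (?bad 0 \<union> ?bad 1)"
      by (intro finite_UnI poly_roots_finite) auto
    then have "\<forall>\<^sub>F t in at 0. t \<notin> ?bad 0 \<union> ?bad 1"
      using islimpt_finite[of "?bad 0 \<union> ?bad 1" 0] unfolding islimpt_iff_eventually by simp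
    then have "\<forall>\<^sub>F t in at 0. ?d t = 0"
    proof eventually_elim
      case (elim t)
      then have "(a + t) * (b + t) \<notin> {0, 1}"
        by (auto simp: algebra_simps)
      then show ?case using R S by (simp add: is_ratio_rhs_extension_def)
    qed
    then have "(?d \<longlongrightarrow> 0) (at 0)" by (rule tendsto_eventually)
    moreover have "continuous_on UNIV ?d"
      using R S unfolding is_ratio_rhs_extension_def
      by (auto intro!: continuous_intros continuous_on_compose2[of UNIV R] continuous_on_compose2[of UNIV S])
    then have "(?d \<longlongrightarrow> ?d 0) (at 0)"
      by (metis (mono_tags, lifting) UNIV_I continuous_on_eq_continuous_at isCont_def open_UNIV)
    ultimately have "?d 0 = 0" using LIM_unique by blast
    then show ?thesis by simp
  qed
  then show "R = S" by auto
qed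

lemma ratio_rhs_generic:
  assumes "C * D \<noteq> 1" "A * B \<notin> {0, 1}"
  shows "ratio_rhs N A B C D = ratio_rhs_generic N A B C D"
  using theI'[OF ratio_rhs_ex1[OF assms(1), of N]] assms(2)
  by (simp add: ratio_rhs_def is_ratio_rhs_extension_def)

lemma continuous_on_ratio_rhs:
  assumes "C * D \<noteq> 1"
  shows "continuous_on UNIV (\<lambda>(A, B). ratio_rhs N A B C D)"
  using theI'[OF ratio_rhs_ex1[OF assms, of N]]
  by (simp add: ratio_rhs_def is_ratio_rhs_extension_def)

end

theory Submission
  imports Defs "HOL-Complex_Analysis.Conformal_Mappings"
begin

text \<open>
  Write \<open>f = det (1 - A u) / det (1 - C u)\<close>, \<open>h = det (1 - B u\<^sup>*) / det (1 - D u\<^sup>*)\<close> and \<open>E\<close> for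
  the Haar average.  Since \<open>f = 1 + (C - A) * (\<Sum>a b. C^a * (-A)^b * s(a|b))\<close> with the Schur functions
  of the hooks \<open>(a|b)\<close>, \<open>0 \<le> b < N\<close>, and likewise for \<open>h\<close>, the formula says that the hook characters are
  orthonormal.  The proof gets this from translation invariance alone, and characters
  occur in it only as motivation.

  \<^emph>\<open>Loop equations.\<close>  Replace \<open>u\<close> by \<open>g u\<close> with \<open>g = 1 + \<zeta> v v\<^sup>*\<close> unitary.  Each determinant
  then changes by the factor \<open>1 - \<zeta> z v\<^sup>* T v\<close>, where \<open>T = u (1 - z u)\<^sup>-\<^sup>1\<close> (lemma
  \<open>rcharpoly_mult_reflection\<close>), so invariance relates averages that are rational in \<open>\<zeta>\<close>.  Their first
  and second order terms at \<open>\<zeta> = 0\<close>, summed over suitable \<open>v\<close>, are the two identities \<open>loop_first\<close>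
  and \<open>loop_second\<close>.  The first one equates the Euler operators \<open>A \<partial>\<^sub>A + C \<partial>\<^sub>C\<close> and
  \<open>B \<partial>\<^sub>B + D \<partial>\<^sub>D\<close> on \<open>E[f h]\<close>: only hooks of equal size pair.  The second one is self-adjointness
  of the quadratic Casimir operator, which has distinct eigenvalues on the hooks of a given size.

  \<^emph>\<open>Differential equations.\<close>  Put \<open>\<Psi> = (E[f h] - 1) / ((C - A) (D - B))\<close>.  The loop equations show
  first that \<open>X = (A \<partial>\<^sub>A + C \<partial>\<^sub>C) E[f h] / ((C - A) (D - B))\<close> does not change under
  \<open>(C, D) \<mapsto> (t C, D / t)\<close> (lemma \<open>radial_mean_quotient_invariant\<close>).  As \<open>X\<close> is the derivative of
  \<open>z \<Psi>(z A, B, z C, D)\<close> at \<open>z = 1\<close>, integration along the ray gives the same invariance for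
  \<open>\<Psi>\<close> (lemma \<open>ratio_mean_quotient_invariant\<close>).

  \<^emph>\<open>Evaluation.\<close>  Choose \<open>t\<close> with \<open>B t C = 1\<close>.  There \<open>det (1 - t C u)\<close> and \<open>det (1 - B u\<^sup>*)\<close> are
  proportional up to \<open>det u\<close>, the average degenerates to one that involves \<open>u\<^sup>*\<close> only, and such an
  average equals 1; so \<open>E[f h] = (A B)\<^sup>N\<close> (lemma \<open>expectation_reciprocal\<close>).  This determines \<open>\<Psi>\<close>
  on an open set of parameters, and both sides of the formula are holomorphic in \<open>A\<close>, \<open>B\<close> and \<open>C\<close>
  (lemma \<open>expectation_ratio\<close>).
\<close>

section \<open>Determinants and resolvents of complex matrices\<close>

abbreviation smat :: "complex \<Rightarrow> complex^'n^'m \<Rightarrow> complex^'n^'m" where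
  "smat z X \<equiv> map_matrix ((*) z) X"

lemma smat_mult_left: "smat z X ** Y = smat z (X ** Y)"
  by (simp add: vec_eq_iff matrix_matrix_mult_def sum_distrib_left mult.assoc)

lemma smat_mult_right: "X ** smat z Y = smat z (X ** Y)"
  by (simp add: vec_eq_iff matrix_matrix_mult_def sum_distrib_left mult_ac)

lemma trace_smat: "trace (smat z X) = z * trace X"
  by (simp add: trace_def sum_distrib_left)

lemma matrix_diff_ldistrib: "A ** (B - C) = A ** B - A ** (C :: complex^'n^'m)"
  by (simp add: vec_eq_iff matrix_matrix_mult_def sum_subtractf right_diff_distrib)

lemma matrix_diff_rdistrib: "(B - C) ** A = B ** A - (C :: complex^'n^'m) ** A"
  by (simp add: vec_eq_iff matrix_matrix_mult_def sum_subtractf left_diff_distrib)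

lemma matrix_add_rdistrib': "(B + C) ** A = B ** A + (C :: complex^'n^'m) ** A"
  by (simp add: vec_eq_iff matrix_matrix_mult_def sum.distrib distrib_right)

lemma det_smat: "det (smat z X) = z ^ CARD('n) * det (X :: complex^'n^'n)"
  by (simp add: det_def prod.distrib sum_distrib_left mult_ac)

lemma matrix_inv_left_right:
  fixes A :: "complex^'n^'n"
  assumes "det A \<noteq> 0"
  shows "matrix_inv A ** A = mat 1" "A ** matrix_inv A = mat 1"
proof -
  have "invertible A" using assms invertible_det_nz by blast
  then have "A ** matrix_inv A = mat 1 \<and> matrix_inv A ** A = mat 1"
    unfolding invertible_def matrix_inv_def by (rule someI_ex)
  then show "matrix_inv A ** A = mat 1" "A ** matrix_inv A = mat 1" by auto
qed

lemma matrix_inv_unique: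
  fixes A B :: "complex^'n^'n"
  assumes "A ** B = mat 1"
  shows "matrix_inv A = B"
proof -
  have "B ** A = mat 1" using assms matrix_left_right_inverse by blast
  then have "det A \<noteq> 0" using assms invertible_det_nz[of A] invertible_def by blast
  have "matrix_inv A = matrix_inv A ** (A ** B)" using assms by simp
  also have "\<dots> = B" using matrix_inv_left_right[OF \<open>det A \<noteq> 0\<close>] by (simp add: matrix_mul_assoc)
  finally show ?thesis .
qed

text \<open>Cramer's rule exhibits the entries of the inverse as rational functions of the matrix entries;
  this is how continuity of resolvents is obtained below.\<close>
lemma matrix_inv_entry:
  fixes A :: "complex^'n^'n"
  assumes "det A \<noteq> 0"
  shows "matrix_inv A $ k $ l = det (\<chi> i j. if j = k then (if i = l then 1 else 0) else A $ i $ j) / det A"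
proof -
  have "A *v (matrix_inv A *v axis l 1) = axis l 1"
    by (simp add: matrix_vector_mul_assoc matrix_inv_left_right[OF assms])
  then have "(matrix_inv A *v axis l 1) $ k = det (\<chi> i j. if j = k then axis l 1 $ i else A $ i $ j) / det A"
    using cramer[OF assms, of "matrix_inv A *v axis l 1" "axis l 1"] by simp
  moreover have "(matrix_inv A *v axis l 1) $ k = matrix_inv A $ k $ l"
    by (simp add: matrix_vector_mult_def axis_def if_distrib cong: if_cong)
  ultimately show ?thesis by (simp add: axis_def cong: if_cong)
qed

lemma det_replace_row_mat1:
  fixes y :: "complex^'n"
  shows "det (\<chi> i. if i = k then y else axis i 1) = y $ k"
proof -
  have "row i (mat 1 :: complex^'n^'n) = axis i 1" for i
    by (simp add: vec_eq_iff row_def mat_def axis_def)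
  moreover have "(\<Sum>i\<in>UNIV. y $ i *s axis i 1) = y"
    by (simp add: vec_eq_iff axis_def if_distrib cong: if_cong)
  ultimately show ?thesis
    using cramer_lemma_transpose[of k y "mat 1"] by (simp cong: if_cong)
qed

text \<open>Subtracting multiples of row \<open>k\<close> clears all the other rows.\<close>
lemma det_rank_one_row:
  fixes x y :: "complex^'n"
  assumes "k \<notin> S"
  shows "det (\<chi> i. if i = k then y else if i \<in> S then axis i 1 + x $ i *s y else axis i 1) = y $ k"
  using finite[of S] assms
proof (induction S rule: finite_induct)
  case empty
  then show ?case by (simp add: det_replace_row_mat1 cong: if_cong)
next
  case (insert j S)
  define A where "A = (\<chi> i. if i = k then y else if i \<in> S then axis i 1 + x $ i *s y else axis i 1)"
  have "j \<noteq> k" using insert by auto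
  then have "(\<chi> i. if i = k then y else if i \<in> insert j S then axis i 1 + x $ i *s y else axis i 1)
    = (\<chi> i. if i = j then row j A + x $ j *s row k A else row i A)"
    using insert.hyps by (auto simp: vec_eq_iff A_def row_def)
  then have "det (\<chi> i. if i = k then y else if i \<in> insert j S then axis i 1 + x $ i *s y else axis i 1) = det A"
    using det_row_operation[OF \<open>j \<noteq> k\<close>, of A "x $ j"] by simp
  then show ?case using insert by (simp add: A_def)
qed

text \<open>The rank one perturbation is switched on row by row, so that multilinearity of the determinant
  applies.\<close>
lemma det_rank_one_aux:
  fixes x y :: "complex^'n"
  shows "det (\<chi> i. if i \<in> S then axis i 1 + x $ i *s y else axis i 1) = 1 + (\<Sum>i\<in>S. x $ i * y $ i)"
  using finite[of S]
proof (induction S rule: finite_induct)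
  case empty
  have "(\<chi> i. axis i 1) = (mat 1 :: complex^'n^'n)"
    by (auto simp: vec_eq_iff mat_def axis_def)
  then show ?case by simp
next
  case (insert k S)
  let ?r = "\<lambda>i. if i \<in> S then axis i 1 + x $ i *s y else axis i 1"
  have "det (\<chi> i. if i \<in> insert k S then axis i 1 + x $ i *s y else axis i 1)
      = det (\<chi> i. if i = k then axis k 1 + x $ k *s y else ?r i)"
    by (rule arg_cong[where f = det]) (auto simp: vec_eq_iff)
  also have "\<dots> = det (\<chi> i. if i = k then axis k 1 else ?r i) + det (\<chi> i. if i = k then x $ k *s y else ?r i)"
    by (rule det_row_add)
  also have "(\<chi> i. if i = k then axis k 1 else ?r i) = (\<chi> i. ?r i)"
    using insert.hyps by (auto simp: vec_eq_iff)
  also have "det (\<chi> i. if i = k then x $ k *s y else ?r i) = x $ k * det (\<chi> i. if i = k then y else ?r i)"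
    by (rule det_row_mul)
  also have "det (\<chi> i. if i = k then y else ?r i) = y $ k"
    by (rule det_rank_one_row) (use insert in auto)
  finally show ?case using insert by simp
qed

lemma det_rank_one:
  fixes x y :: "complex^'n"
  shows "det (mat 1 - (\<chi> i j. x $ i * y $ j)) = 1 - (\<Sum>i\<in>UNIV. x $ i * y $ i)"
proof -
  have "mat 1 - (\<chi> i j. x $ i * y $ j) = (\<chi> i. if i \<in> UNIV then axis i 1 + (- x) $ i *s y else axis i 1)"
    by (auto simp: vec_eq_iff mat_def axis_def)
  then have "det (mat 1 - (\<chi> i j. x $ i * y $ j)) = 1 + (\<Sum>i\<in>UNIV. (- x) $ i * y $ i)"
    by (simp only: det_rank_one_aux)
  then show ?thesis by (simp add: sum_negf)
qed

text \<open>Jacobi's formula in the row form, which also makes sense at singular matrices.\<close>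
lemma det_has_field_derivative:
  fixes M :: "complex \<Rightarrow> complex^'n^'n"
  assumes "\<And>i j. ((\<lambda>z. M z $ i $ j) has_field_derivative M' $ i $ j) (at z)"
  shows "((\<lambda>z. det (M z)) has_field_derivative
           (\<Sum>k\<in>UNIV. det (\<chi> i. if i = k then M' $ i else M z $ i))) (at z)"
proof -
  let ?P = "{p. p permutes (UNIV :: 'n set)}"
  have *: "(\<Prod>i\<in>UNIV. (\<chi> i. if i = k then M' $ i else M z $ i) $ i $ p i)
      = M' $ k $ p k * (\<Prod>i\<in>UNIV - {k}. M z $ i $ p i)" for k p
  proof -
    have "(\<Prod>i\<in>UNIV. (\<chi> i. if i = k then M' $ i else M z $ i) $ i $ p i)
      = (\<chi> i. if i = k then M' $ i else M z $ i) $ k $ p k *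
         (\<Prod>i\<in>UNIV - {k}. (\<chi> i. if i = k then M' $ i else M z $ i) $ i $ p i)"
      by (rule prod.remove) auto
    then show ?thesis by simp
  qed
  have "((\<lambda>z. \<Sum>p\<in>?P. of_int (sign p) * (\<Prod>i\<in>UNIV. M z $ i $ p i)) has_field_derivative
     (\<Sum>p\<in>?P. of_int (sign p) * (\<Sum>k\<in>UNIV. M' $ k $ p k * (\<Prod>i\<in>UNIV - {k}. M z $ i $ p i)))) (at z)"
    by (intro DERIV_sum DERIV_cmult has_field_derivative_prod assms)
  also have "(\<Sum>p\<in>?P. of_int (sign p) * (\<Sum>k\<in>UNIV. M' $ k $ p k * (\<Prod>i\<in>UNIV - {k}. M z $ i $ p i)))
    = (\<Sum>k\<in>UNIV. det (\<chi> i. if i = k then M' $ i else M z $ i))"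
    unfolding det_def * sum_distrib_left by (rule sum.swap)
  finally show ?thesis unfolding det_def .
qed

text \<open>\<open>rcharpoly z X\<close> is the reversed characteristic polynomial of \<open>X\<close>, evaluated at \<open>z\<close>.\<close>
definition rcharpoly :: "complex \<Rightarrow> complex^'n^'n \<Rightarrow> complex" where
  "rcharpoly z X = det (mat 1 - smat z X)"

definition rcharpoly' :: "complex \<Rightarrow> complex^'n^'n \<Rightarrow> complex" where
  "rcharpoly' z X = (\<Sum>k\<in>UNIV. det (\<chi> i. if i = k then - X $ i else (mat 1 - smat z X) $ i))"

text \<open>The extra factor \<open>X\<close> makes \<open>z \<mapsto> resolvent z X\<close> a solution of \<open>T' = T\<^sup>2\<close>, and its trace is minus the
  logarithmic derivative of \<open>rcharpoly z X\<close>.\<close>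
definition resolvent :: "complex \<Rightarrow> complex^'n^'n \<Rightarrow> complex^'n^'n" where
  "resolvent z X = X ** matrix_inv (mat 1 - smat z X)"

lemma rcharpoly_0 [simp]: "rcharpoly 0 X = 1"
proof -
  have "mat 1 - smat 0 X = mat 1" by (simp add: vec_eq_iff)
  then show ?thesis by (simp add: rcharpoly_def)
qed

lemma DERIV_rcharpoly: "((\<lambda>z. rcharpoly z X) has_field_derivative rcharpoly' z X) (at z)"
proof -
  have "((\<lambda>z. det (mat 1 - smat z X)) has_field_derivative
     (\<Sum>k\<in>UNIV. det (\<chi> i. if i = k then (- X) $ i else (mat 1 - smat z X) $ i))) (at z)"
    by (rule det_has_field_derivative) (auto intro!: derivative_eq_intros)
  then show ?thesis by (simp add: rcharpoly_def rcharpoly'_def cong: if_cong)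
qed

lemma resolvent_facts:
  assumes "rcharpoly z X \<noteq> 0"
  shows "resolvent z X = matrix_inv (mat 1 - smat z X) ** X"
    and "matrix_inv (mat 1 - smat z X) = mat 1 + smat z (resolvent z X)"
    and "resolvent z X ** (mat 1 - smat z X) = X"
    and "(mat 1 - smat z X) ** resolvent z X = X"
proof -
  define S where "S = matrix_inv (mat 1 - smat z X)"
  have L: "S ** (mat 1 - smat z X) = mat 1" and R: "(mat 1 - smat z X) ** S = mat 1"
    using assms matrix_inv_left_right unfolding rcharpoly_def S_def by blast+
  have comm: "X ** (mat 1 - smat z X) = (mat 1 - smat z X) ** X"
    by (simp add: matrix_diff_ldistrib matrix_diff_rdistrib smat_mult_left smat_mult_right)
  have "X ** S = S ** ((mat 1 - smat z X) ** X) ** S"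
    by (simp add: matrix_mul_assoc L)
  also have "\<dots> = S ** X ** ((mat 1 - smat z X) ** S)"
    by (simp flip: comm add: matrix_mul_assoc)
  finally have XS: "X ** S = S ** X" by (simp add: R)
  show "resolvent z X = matrix_inv (mat 1 - smat z X) ** X"
    using XS by (simp add: resolvent_def S_def)
  have "S - smat z (X ** S) = mat 1"
    using R by (simp add: matrix_diff_rdistrib smat_mult_left)
  then show "matrix_inv (mat 1 - smat z X) = mat 1 + smat z (resolvent z X)"
    by (simp add: resolvent_def S_def[symmetric] diff_eq_eq)
  show "resolvent z X ** (mat 1 - smat z X) = X"
    by (simp add: resolvent_def S_def[symmetric] L flip: matrix_mul_assoc)
  show "(mat 1 - smat z X) ** resolvent z X = X"
    by (simp add: resolvent_def S_def[symmetric] XS) (simp add: matrix_mul_assoc R)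
qed

text \<open>The rows of the derivative \<open>- X\<close> are combinations of the rows of \<open>1 - z X\<close>, with the rows of
  \<open>- resolvent z X\<close> as coefficients, so Cramer's rule evaluates each replaced determinant.\<close>
lemma rcharpoly'_eq:
  assumes "rcharpoly z X \<noteq> 0"
  shows "rcharpoly' z X = - trace (resolvent z X) * rcharpoly z X"
proof -
  have "det (\<chi> i. if i = k then - X $ i else (mat 1 - smat z X) $ i) = - resolvent z X $ k $ k * rcharpoly z X" for k
  proof -
    let ?A = "mat 1 - smat z X"
    have "(\<Sum>i\<in>UNIV. (- resolvent z X $ k) $ i *s row i ?A) = - (resolvent z X ** ?A) $ k"
      by (simp add: vec_eq_iff matrix_matrix_mult_def row_def sum_negf)
    also have "\<dots> = - X $ k" using resolvent_facts(3)[OF assms] by simp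
    finally have "(\<Sum>i\<in>UNIV. (- resolvent z X $ k) $ i *s row i ?A) = - X $ k" .
    with cramer_lemma_transpose[of k "- resolvent z X $ k" ?A]
    have "det (\<chi> i. if i = k then - X $ k else row i ?A) = - resolvent z X $ k $ k * rcharpoly z X"
      by (simp only: rcharpoly_def) simp
    moreover have "(\<chi> i. if i = k then - X $ k else row i ?A) = (\<chi> i. if i = k then - X $ i else ?A $ i)"
      by (auto simp: vec_eq_iff row_def)
    ultimately show ?thesis by simp
  qed
  then show ?thesis
    by (simp add: rcharpoly'_def trace_def sum_negf sum_distrib_right)
qed

lemma resolvent_diff:
  assumes "rcharpoly a X \<noteq> 0" "rcharpoly b X \<noteq> 0"
  shows "resolvent a X - resolvent b X = smat (a - b) (resolvent a X ** resolvent b X)"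
proof -
  let ?Sa = "matrix_inv (mat 1 - smat a X)" and ?Sb = "matrix_inv (mat 1 - smat b X)"
  have L: "?Sa ** (mat 1 - smat a X) = mat 1" and R: "(mat 1 - smat b X) ** ?Sb = mat 1"
    using assms matrix_inv_left_right unfolding rcharpoly_def by blast+
  have "resolvent a X - resolvent b X = ?Sa ** X ** ((mat 1 - smat b X) ** ?Sb) - (?Sa ** (mat 1 - smat a X)) ** X ** ?Sb"
    unfolding L R resolvent_facts(1)[OF assms(1)] by (simp add: resolvent_def)
  also have "\<dots> = ?Sa ** (X ** (mat 1 - smat b X) - (mat 1 - smat a X) ** X) ** ?Sb"
    by (simp add: matrix_mul_assoc matrix_diff_ldistrib matrix_diff_rdistrib)
  also have "X ** (mat 1 - smat b X) - (mat 1 - smat a X) ** X = smat (a - b) (X ** X)"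
    by (simp add: matrix_diff_ldistrib matrix_diff_rdistrib smat_mult_left smat_mult_right)
       (simp add: vec_eq_iff algebra_simps)
  also have "?Sa ** smat (a - b) (X ** X) ** ?Sb = smat (a - b) (resolvent a X ** resolvent b X)"
    unfolding resolvent_facts(1)[OF assms(1)] by (simp add: resolvent_def smat_mult_left smat_mult_right matrix_mul_assoc)
  finally show ?thesis .
qed

lemma trace_resolvent_mult:
  assumes "rcharpoly a X \<noteq> 0" "rcharpoly b X \<noteq> 0"
  shows "(a - b) * trace (resolvent a X ** resolvent b X) = trace (resolvent a X) - trace (resolvent b X)"
  using arg_cong[OF resolvent_diff[OF assms], of trace] by (simp add: trace_smat trace_sub)

section \<open>Continuity in the parameters\<close>

lemma continuous_on_det:
  fixes M :: "'a::topological_space \<Rightarrow> complex^'n^'n"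
  assumes "\<And>i j. continuous_on S (\<lambda>x. M x $ i $ j)"
  shows "continuous_on S (\<lambda>x. det (M x))"
  unfolding det_def by (intro continuous_intros assms)

lemma continuous_on_rcharpoly [continuous_intros]:
  assumes "continuous_on S a" "continuous_on S X"
  shows "continuous_on S (\<lambda>x. rcharpoly (a x) (X x))"
  unfolding rcharpoly_def
  by (rule continuous_on_det) (use assms in \<open>auto simp: mat_def intro!: continuous_intros\<close>)

lemma continuous_on_rcharpoly' [continuous_intros]:
  assumes "continuous_on S a" "continuous_on S X"
  shows "continuous_on S (\<lambda>x. rcharpoly' (a x) (X x))"
proof -
  have "continuous_on S (\<lambda>x. (\<chi> i. if i = k then - X x $ i else (mat 1 - smat (a x) (X x)) $ i) $ i $ j)" for i j k
    using assms by (cases "i = k") (auto simp: mat_def intro!: continuous_intros)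
  then show ?thesis
    unfolding rcharpoly'_def by (intro continuous_on_sum continuous_on_det)
qed

lemma continuous_on_resolvent_entry:
  assumes "continuous_on S a" "continuous_on S X" "\<And>x. x \<in> S \<Longrightarrow> rcharpoly (a x) (X x) \<noteq> 0"
  shows "continuous_on S (\<lambda>x. resolvent (a x) (X x) $ i $ j)"
proof -
  have "continuous_on S (\<lambda>x. det (\<chi> i j. if j = k then (if i = l then 1 else 0)
             else (mat 1 - smat (a x) (X x)) $ i $ j) / rcharpoly (a x) (X x))" for k l
  proof (intro continuous_on_divide continuous_on_rcharpoly assms(1,2) continuous_on_det)
    show "\<forall>x\<in>S. rcharpoly (a x) (X x) \<noteq> 0" using assms(3) by blast
    fix i j
    show "continuous_on S (\<lambda>x. (\<chi> i j. if j = k then (if i = l then 1 else 0)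
             else (mat 1 - smat (a x) (X x)) $ i $ j) $ i $ j)"
      using assms by (cases "j = k") (auto simp: mat_def intro!: continuous_intros)
  qed
  then have "continuous_on S (\<lambda>x. matrix_inv (mat 1 - smat (a x) (X x)) $ k $ l)" for k l
    by (subst continuous_on_cong[OF refl matrix_inv_entry]) (use assms in \<open>auto simp: rcharpoly_def\<close>)
  then have "continuous_on S (\<lambda>x. \<chi> k l. matrix_inv (mat 1 - smat (a x) (X x)) $ k $ l)"
    by (intro continuous_on_vec_lambda)
  then show ?thesis
    unfolding resolvent_def matrix_matrix_mult_def by (auto intro!: continuous_intros assms)
qed

lemma continuous_on_resolvent [continuous_intros]:
  assumes "continuous_on S a" "continuous_on S X" "\<And>x. x \<in> S \<Longrightarrow> rcharpoly (a x) (X x) \<noteq> 0"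
  shows "continuous_on S (\<lambda>x. resolvent (a x) (X x))"
proof -
  have "continuous_on S (\<lambda>x. \<chi> i j. resolvent (a x) (X x) $ i $ j)"
    by (intro continuous_on_vec_lambda continuous_on_resolvent_entry assms)
  then show ?thesis by simp
qed

lemma continuous_on_trace [continuous_intros]:
  assumes "continuous_on S (X :: _ \<Rightarrow> complex^'n^'n)"
  shows "continuous_on S (\<lambda>x. trace (X x))"
  unfolding trace_def by (auto intro!: continuous_intros assms)

lemma continuous_on_matrix_mult [continuous_intros]:
  assumes "continuous_on S (X :: _ \<Rightarrow> complex^'n^'m)" "continuous_on S (Y :: _ \<Rightarrow> complex^'k^'n)"
  shows "continuous_on S (\<lambda>x. X x ** Y x)"
  unfolding matrix_matrix_mult_def by (auto intro!: continuous_intros assms)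

section \<open>The unitary group and its rank one reflections\<close>

definition adj :: "complex^'n^'n \<Rightarrow> complex^'n^'n" where
  "adj u = map_matrix cnj (transpose u)"

lemma adj_nth [simp]: "adj u $ i $ j = cnj (u $ j $ i)"
  by (simp add: adj_def transpose_def)

lemma adj_adj [simp]: "adj (adj u) = u"
  by (simp add: vec_eq_iff)

lemma adj_mult: "adj (u ** v) = adj v ** adj u"
  by (simp add: vec_eq_iff matrix_matrix_mult_def mult.commute)

lemma continuous_on_adj [continuous_intros]:
  assumes "continuous_on S X"
  shows "continuous_on S (\<lambda>x. adj (X x))"
  unfolding adj_def map_matrix_def transpose_def by (auto intro!: continuous_intros assms)

lemma unitary_iff: "u \<in> unitary_group \<longleftrightarrow> u ** adj u = mat 1 \<and> adj u ** u = mat 1"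
  by (simp add: unitary_group_def adj_def)

lemma unitary_adj: "u \<in> unitary_group \<Longrightarrow> adj u \<in> unitary_group"
  by (simp add: unitary_iff)

lemma unitary_mult: "u \<in> unitary_group \<Longrightarrow> v \<in> unitary_group \<Longrightarrow> u ** v \<in> unitary_group"
  unfolding unitary_iff adj_mult
  by (metis matrix_mul_assoc matrix_mul_rid)

lemma unitary_matrix_inv: "u \<in> unitary_group \<Longrightarrow> matrix_inv u = adj u"
  by (simp add: unitary_iff matrix_inv_unique)

lemma norm_vec_square:
  fixes y :: "complex^'n"
  shows "complex_of_real ((norm y)\<^sup>2) = (\<Sum>i\<in>UNIV. cnj (y $ i) * y $ i)"
proof -
  have "cnj c * c = complex_of_real ((norm c)\<^sup>2)" for c
    by (simp only: complex_norm_square mult.commute)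
  then show ?thesis
    by (simp add: norm_vec_def L2_set_def sum_nonneg)
qed

lemma norm_vector_smult: "norm (z *s y) = norm z * norm (y :: complex^'n)"
  by (simp add: norm_vec_def norm_mult L2_set_right_distrib)

lemma unitary_norm:
  assumes "u \<in> unitary_group"
  shows "norm (u *v x) = norm x"
proof -
  have "complex_of_real ((norm (u *v x))\<^sup>2)
      = (\<Sum>i\<in>UNIV. \<Sum>j\<in>UNIV. \<Sum>k\<in>UNIV. cnj (x $ j) * (adj u $ j $ i * u $ i $ k) * x $ k)"
    unfolding norm_vec_square by (simp add: matrix_vector_mult_def sum_distrib_left sum_distrib_right mult_ac)
  also have "\<dots> = (\<Sum>j\<in>UNIV. \<Sum>i\<in>UNIV. \<Sum>k\<in>UNIV. cnj (x $ j) * (adj u $ j $ i * u $ i $ k) * x $ k)"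
    by (rule sum.swap)
  also have "\<dots> = (\<Sum>j\<in>UNIV. \<Sum>k\<in>UNIV. \<Sum>i\<in>UNIV. cnj (x $ j) * (adj u $ j $ i * u $ i $ k) * x $ k)"
    by (rule sum.cong[OF refl], rule sum.swap)
  also have "\<dots> = (\<Sum>j\<in>UNIV. \<Sum>k\<in>UNIV. cnj (x $ j) * (adj u ** u) $ j $ k * x $ k)"
    by (simp add: matrix_matrix_mult_def sum_distrib_left sum_distrib_right)
  also have "\<dots> = complex_of_real ((norm x)\<^sup>2)"
    using assms unfolding norm_vec_square unitary_iff
    by (simp add: mat_def if_distrib if_distribR cong: if_cong)
  finally have "(norm (u *v x))\<^sup>2 = (norm x)\<^sup>2" using of_real_eq_iff by blast
  then show ?thesis by simp
qed

text \<open>A kernel vector \<open>x\<close> of \<open>1 - z u\<close> satisfies \<open>x = z u x\<close>, hence \<open>|x| = |z| |x|\<close>.\<close>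
lemma rcharpoly_unitary_nonzero:
  assumes "u \<in> unitary_group" "norm z \<noteq> 1"
  shows "rcharpoly z u \<noteq> 0"
proof -
  have "x = 0" if "(mat 1 - smat z u) *v x = 0" for x
  proof -
    have "x = smat z u *v x" using that by (simp add: matrix_vector_mult_diff_rdistrib)
    also have "\<dots> = z *s (u *v x)"
      by (simp add: vec_eq_iff matrix_vector_mult_def sum_distrib_left mult.assoc)
    finally have "norm x = norm (z *s (u *v x))" by simp
    also have "\<dots> = norm z * norm x"
      by (simp add: norm_vector_smult unitary_norm[OF assms(1)])
    finally show ?thesis using assms(2) by simp
  qed
  then have "\<exists>B. B ** (mat 1 - smat z u) = mat 1"
    using matrix_left_invertible_ker[of "mat 1 - smat z u"] by blast
  then have "invertible (mat 1 - smat z u)"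
    using invertible_left_inverse by blast
  then show ?thesis by (simp add: rcharpoly_def invertible_det_nz)
qed

lemma compact_unitary_group: "compact (unitary_group :: (complex^'n^'n) set)"
  unfolding compact_eq_bounded_closed
proof
  have "norm u \<le> CARD('n)" if "u \<in> unitary_group" for u :: "complex^'n^'n"
  proof -
    have "norm (u $ i) \<le> 1" for i
    proof -
      have "complex_of_real ((norm (u $ i))\<^sup>2) = (u ** adj u) $ i $ i"
        by (simp only: norm_vec_square) (simp add: matrix_matrix_mult_def mult.commute)
      also have "\<dots> = of_real 1" using that by (simp add: unitary_iff mat_def)
      finally have "(norm (u $ i))\<^sup>2 = 1" using of_real_eq_iff by blast
      then show ?thesis using power2_le_imp_le[of "norm (u $ i)" 1] by simp
    qed
    then have "(\<Sum>i\<in>UNIV. norm (u $ i)) \<le> (\<Sum>i\<in>(UNIV::'n set). 1)" by (intro sum_mono)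
    moreover have "norm u \<le> (\<Sum>i\<in>UNIV. norm (u $ i))" unfolding norm_vec_def by (rule L2_set_le_sum) simp
    ultimately show ?thesis by simp
  qed
  then show "bounded (unitary_group :: (complex^'n^'n) set)" by (meson boundedI)
  have "closed {u :: complex^'n^'n. u ** adj u = mat 1}" "closed {u :: complex^'n^'n. adj u ** u = mat 1}"
    by (auto intro!: closed_Collect_eq continuous_intros)
  then have "closed ({u :: complex^'n^'n. u ** adj u = mat 1} \<inter> {u. adj u ** u = mat 1})"
    by (rule closed_Int)
  also have "{u :: complex^'n^'n. u ** adj u = mat 1} \<inter> {u. adj u ** u = mat 1} = unitary_group"
    by (auto simp: unitary_iff)
  finally show "closed (unitary_group :: (complex^'n^'n) set)" .
qed

definition herm_form :: "complex^'n \<Rightarrow> complex^'n^'n \<Rightarrow> complex" where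
  "herm_form v X = (\<Sum>i\<in>UNIV. \<Sum>j\<in>UNIV. cnj (v $ i) * X $ i $ j * v $ j)"

definition reflection :: "complex^'n \<Rightarrow> complex \<Rightarrow> complex^'n^'n" where
  "reflection v \<zeta> = mat 1 + (\<chi> i j. \<zeta> * v $ i * cnj (v $ j))"

text \<open>The hypothesis says that \<open>1 + |v|\<^sup>2 \<zeta>\<close> lies on the unit circle when \<open>v\<close> is not zero.\<close>
lemma reflection_unitary:
  assumes "\<zeta> + cnj \<zeta> + complex_of_real ((norm v)\<^sup>2) * \<zeta> * cnj \<zeta> = 0"
  shows "reflection v \<zeta> \<in> unitary_group"
proof -
  define m where "m = complex_of_real ((norm v)\<^sup>2)"
  have m: "(\<Sum>i\<in>UNIV. cnj (v $ i) * v $ i) = m"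
    unfolding m_def by (rule norm_vec_square[symmetric])
  define O' where "O' = (\<lambda>\<zeta>::complex. (\<chi> i j. \<zeta> * v $ i * cnj (v $ j)))"
  have prod: "O' a ** O' b = O' (m * a * b)" for a b
  proof -
    have "(\<Sum>k\<in>UNIV. a * v $ i * cnj (v $ k) * (b * v $ k * cnj (v $ j)))
       = a * b * v $ i * cnj (v $ j) * (\<Sum>k\<in>UNIV. cnj (v $ k) * v $ k)" for i j
      by (simp add: sum_distrib_left mult_ac)
    then show ?thesis unfolding m
      by (simp add: vec_eq_iff O'_def matrix_matrix_mult_def mult_ac)
  qed
  have "adj (reflection v \<zeta>) = mat 1 + O' (cnj \<zeta>)"
    by (auto simp: vec_eq_iff reflection_def O'_def mat_def mult_ac)
  moreover have "reflection v \<zeta> = mat 1 + O' \<zeta>" by (simp add: reflection_def O'_def)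
  moreover have "(mat 1 + O' a) ** (mat 1 + O' b) = mat 1 + O' (a + b + m * a * b)" for a b
    by (simp add: matrix_add_ldistrib matrix_add_rdistrib' prod)
       (simp add: O'_def vec_eq_iff algebra_simps)
  moreover have "O' (\<zeta> + cnj \<zeta> + m * \<zeta> * cnj \<zeta>) = 0" "O' (cnj \<zeta> + \<zeta> + m * cnj \<zeta> * \<zeta>) = 0"
    using assms unfolding m_def[symmetric] by (simp_all add: O'_def vec_eq_iff add.commute mult.assoc mult.commute[of \<zeta>])
  ultimately show ?thesis by (simp only: unitary_iff add_0_right)
qed

text \<open>\<open>1 - z X (1 + \<zeta> v v\<^sup>*)\<close> factors as \<open>1 - z X\<close> times a rank one perturbation of the identity.\<close>
lemma rcharpoly_mult_reflection:
  fixes X :: "complex^'n^'n"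
  assumes "rcharpoly z X \<noteq> 0"
  shows "rcharpoly z (X ** reflection v \<zeta>) = rcharpoly z X * (1 - \<zeta> * z * herm_form v (resolvent z X))"
proof -
  define y where "y = (\<chi> j. cnj (v $ j))"
  define x where "x = (\<zeta> * z) *s (resolvent z X *v v)"
  have Ax: "(mat 1 - smat z X) *v x = (\<zeta> * z) *s (X *v v)"
    by (simp only: x_def vector_scalar_commute matrix_vector_mul_assoc resolvent_facts(4)[OF assms])
  have outer: "A ** (\<chi> i j. x $ i * y $ j) = (\<chi> i j. (A *v x) $ i * y $ j)" for A :: "complex^'n^'n"
    by (simp add: vec_eq_iff matrix_matrix_mult_def matrix_vector_mult_def sum_distrib_left mult_ac)
  from Ax have "(mat 1 - smat z X) ** (\<chi> i j. x $ i * y $ j) = (\<chi> i j. (\<zeta> * z) * (X *v v) $ i * y $ j)"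
    by (simp add: outer)
  also have "\<dots> = smat z (X ** (\<chi> i j. \<zeta> * v $ i * cnj (v $ j)))"
    by (simp add: vec_eq_iff matrix_matrix_mult_def matrix_vector_mult_def y_def sum_distrib_left sum_distrib_right mult_ac)
  finally have "mat 1 - smat z (X ** reflection v \<zeta>) = (mat 1 - smat z X) ** (mat 1 - (\<chi> i j. x $ i * y $ j))"
    by (simp add: reflection_def matrix_add_ldistrib matrix_diff_ldistrib) (simp add: vec_eq_iff algebra_simps)
  then have "rcharpoly z (X ** reflection v \<zeta>) = rcharpoly z X * (1 - (\<Sum>i\<in>UNIV. x $ i * y $ i))"
    by (simp only: rcharpoly_def det_mul det_rank_one)
  also have "(\<Sum>i\<in>UNIV. x $ i * y $ i) = \<zeta> * z * herm_form v (resolvent z X)"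
    by (simp add: x_def y_def herm_form_def matrix_vector_mult_def sum_distrib_left sum_distrib_right mult_ac)
  finally show ?thesis .
qed

lemma rcharpoly_mult_commute:
  fixes g u :: "complex^'n^'n"
  assumes "g \<in> unitary_group"
  shows "rcharpoly z (g ** u) = rcharpoly z (u ** g)"
proof -
  have "(mat 1 - smat z (g ** u)) ** g = g ** (mat 1 - smat z (u ** g))"
    by (simp add: matrix_diff_ldistrib matrix_diff_rdistrib smat_mult_left smat_mult_right matrix_mul_assoc)
  then have "rcharpoly z (g ** u) * det g = det g * rcharpoly z (u ** g)"
    unfolding rcharpoly_def by (metis det_mul)
  moreover have "det g * det (adj g) = 1"
    using assms by (simp add: unitary_iff flip: det_mul)
  ultimately show ?thesis by auto
qed

section \<open>Integration against Haar measure\<close>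

lemma continuous_on_slice:
  fixes F :: "'a::metric_space \<Rightarrow> complex^'n^'n \<Rightarrow> complex"
  assumes "continuous_on (S \<times> unitary_group) (\<lambda>p. F (fst p) (snd p))" "y \<in> S"
  shows "continuous_on unitary_group (F y)"
proof -
  have "continuous_on unitary_group (\<lambda>u :: complex^'n^'n. (y, u))"
    by (intro continuous_on_Pair continuous_on_const continuous_on_id)
  from continuous_on_compose2[OF assms(1) this] show ?thesis
    using assms(2) by auto
qed

locale haar =
  fixes M :: "(complex^'n^'n) measure"
  assumes haar: "haar_probability M"
begin

sublocale prob_space M
  using haar by (simp add: haar_probability_def)

lemma space_M: "space M = unitary_group"
  using haar by (simp add: haar_probability_def)

lemma measurable_M:
  fixes F :: "complex^'n^'n \<Rightarrow> complex"
  assumes "continuous_on unitary_group F"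
  shows "F \<in> borel_measurable M"
proof -
  have "F \<in> borel_measurable (restrict_space borel unitary_group)"
    using assms by (rule borel_measurable_continuous_on_restrict)
  then show ?thesis
    using haar by (simp add: haar_probability_def cong: measurable_cong_sets)
qed

lemma integrable_M [intro]:
  fixes F :: "complex^'n^'n \<Rightarrow> complex"
  assumes "continuous_on unitary_group F"
  shows "integrable M F"
proof -
  have "bounded (F ` unitary_group)"
    using assms compact_unitary_group compact_continuous_image compact_imp_bounded by blast
  then obtain B where "\<And>u. u \<in> unitary_group \<Longrightarrow> norm (F u) \<le> B"
    unfolding bounded_iff by blast
  then show ?thesis
    by (intro integrable_const_bound[where B = B]) (auto simp: space_M assms measurable_M)
qed

lemma integral_left_invariant:
  fixes F :: "complex^'n^'n \<Rightarrow> complex"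
  assumes "g \<in> unitary_group" "continuous_on unitary_group F"
  shows "(LINT u|M. F (g ** u)) = (LINT u|M. F u)"
proof -
  have g: "(\<lambda>u. g ** u) \<in> measurable M M"
  proof -
    have "(\<lambda>u. g ** u) \<in> measurable (restrict_space borel unitary_group) (restrict_space borel unitary_group)"
      by (rule measurable_restrict_space3)
        (auto intro!: borel_measurable_continuous_onI continuous_intros unitary_mult assms)
    then show ?thesis
      using haar by (simp add: haar_probability_def cong: measurable_cong_sets)
  qed
  have "(LINT u|M. F u) = (LINT u|distr M M (\<lambda>u. g ** u). F u)"
    using haar assms(1) by (simp add: haar_probability_def)
  also have "\<dots> = (LINT u|M. F (g ** u))"
    by (rule integral_distr[OF g measurable_M[OF assms(2)]])
  finally show ?thesis by simp
qed

lemma integral_cong_M: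
  "(\<And>u. u \<in> unitary_group \<Longrightarrow> F u = G u) \<Longrightarrow> (LINT u|M. F u) = (LINT u|M. G u)"
  by (rule Bochner_Integration.integral_cong) (auto simp: space_M)

lemma norm_integral_le:
  fixes F :: "complex^'n^'n \<Rightarrow> complex"
  assumes "continuous_on unitary_group F" "\<And>u. u \<in> unitary_group \<Longrightarrow> norm (F u) \<le> B"
  shows "norm (LINT u|M. F u) \<le> B"
proof -
  have "norm (LINT u|M. F u) \<le> (LINT u|M. norm (F u))"
    by (rule integral_norm_bound)
  also have "\<dots> \<le> B"
    using assms by (intro integral_le_const integrable_norm integrable_M) (auto simp: space_M)
  finally show ?thesis .
qed

lemma continuous_on_integral:
  fixes F :: "'a::metric_space \<Rightarrow> complex^'n^'n \<Rightarrow> complex"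
  assumes "compact S" and F: "continuous_on (S \<times> unitary_group) (\<lambda>p. F (fst p) (snd p))"
  shows "continuous_on S (\<lambda>x. LINT u|M. F x u)"
  unfolding continuous_on_sequentially
proof (intro allI ballI impI, unfold o_def)
  fix X x assume x: "x \<in> S" and X: "(\<forall>n. X n \<in> S) \<and> X \<longlonglongrightarrow> x"
  have "bounded ((\<lambda>p. F (fst p) (snd p)) ` (S \<times> unitary_group))"
    using F assms(1) compact_unitary_group compact_Times compact_continuous_image compact_imp_bounded by blast
  then obtain B where B: "\<And>y u. y \<in> S \<Longrightarrow> u \<in> unitary_group \<Longrightarrow> norm (F y u) \<le> B"
    unfolding bounded_iff by force
  have cont: "continuous_on unitary_group (F y)" if "y \<in> S" for y
    using continuous_on_slice[OF F] that .
  show "(\<lambda>n. LINT u|M. F (X n) u) \<longlonglongrightarrow> (LINT u|M. F x u)"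
  proof (rule integral_dominated_convergence[where w = "\<lambda>_. B"])
    show "AE u in M. (\<lambda>n. F (X n) u) \<longlonglongrightarrow> F x u"
    proof (rule AE_I2)
      fix u assume "u \<in> space M"
      then have u: "u \<in> unitary_group" by (simp add: space_M)
      have "continuous_on S (\<lambda>y. (y, u))"
        by (intro continuous_on_Pair continuous_on_const continuous_on_id)
      from continuous_on_compose2[OF F this] have "continuous_on S (\<lambda>y. F y u)"
        using u by auto
      then show "(\<lambda>n. F (X n) u) \<longlonglongrightarrow> F x u"
        using x X unfolding continuous_on_sequentially o_def by blast
    qed
    show "AE u in M. norm (F (X n) u) \<le> B" for n
      using B X by (auto intro!: AE_I2 simp: space_M)
  qed (use x X cont measurable_M in auto)
qed

text \<open>Differentiation under the integral sign: uniform continuity of \<open>F'\<close> on a compact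
  neighbourhood bounds the error of the linear approximation uniformly in \<open>u\<close>.\<close>
lemma DERIV_integral:
  fixes F F' :: "complex \<Rightarrow> complex^'n^'n \<Rightarrow> complex"
  assumes "open S" "z0 \<in> S"
    and F': "continuous_on (S \<times> unitary_group) (\<lambda>p. F' (fst p) (snd p))"
    and contF: "\<And>z. z \<in> S \<Longrightarrow> continuous_on unitary_group (F z)"
    and deriv: "\<And>z u. z \<in> S \<Longrightarrow> u \<in> unitary_group \<Longrightarrow> ((\<lambda>z. F z u) has_field_derivative F' z u) (at z)"
  shows "((\<lambda>z. LINT u|M. F z u) has_field_derivative (LINT u|M. F' z0 u)) (at z0)"
  unfolding has_field_derivative_def has_derivative_at_alt
proof (intro conjI allI impI)
  show "bounded_linear ((*) (LINT u|M. F' z0 u))" by (rule bounded_linear_mult_right)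
  fix e :: real assume "e > 0"
  obtain r where r: "r > 0" "cball z0 r \<subseteq> S"
    using assms(1,2) open_contains_cball_eq by blast
  have "uniformly_continuous_on (cball z0 r \<times> unitary_group) (\<lambda>p. F' (fst p) (snd p))"
    using r by (intro compact_uniformly_continuous continuous_on_subset[OF F'] compact_Times compact_unitary_group) auto
  then obtain d where d: "d > 0"
    "\<And>p q. p \<in> cball z0 r \<times> unitary_group \<Longrightarrow> q \<in> cball z0 r \<times> unitary_group \<Longrightarrow> dist q p < d \<Longrightarrow>
      dist (F' (fst q) (snd q)) (F' (fst p) (snd p)) < e"
    using \<open>e > 0\<close> unfolding uniformly_continuous_on_def by metis
  have cont': "continuous_on unitary_group (F' z0)"
    using continuous_on_slice[OF F'] assms(2) .
  show "\<exists>d>0. \<forall>y. norm (y - z0) < d \<longrightarrow>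
     norm ((LINT u|M. F y u) - (LINT u|M. F z0 u) - (LINT u|M. F' z0 u) * (y - z0)) \<le> e * norm (y - z0)"
  proof (intro exI[of _ "min d r"] conjI allI impI)
    show "min d r > 0" using d r by simp
    fix y assume y: "norm (y - z0) < min d r"
    let ?B = "ball z0 (min d r)"
    have BS: "z \<in> S" if "z \<in> ?B" for z using that r by auto
    have yB: "y \<in> ?B" using y by (simp add: dist_norm norm_minus_commute)
    have bound: "norm (F y u - F z0 u - F' z0 u * (y - z0)) \<le> e * norm (y - z0)"
      if u: "u \<in> unitary_group" for u
    proof -
      have "norm ((F y u - F' z0 u * y) - (F z0 u - F' z0 u * z0)) \<le> e * norm (y - z0)"
      proof (rule field_differentiable_bound[where S = ?B and f' = "\<lambda>z. F' z u - F' z0 u"])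
        fix z assume z: "z \<in> ?B"
        have "((\<lambda>z. F z u - F' z0 u * z) has_field_derivative F' z u - F' z0 u) (at z)"
          using deriv[OF BS[OF z] u] by (auto intro!: derivative_eq_intros)
        then show "((\<lambda>z. F z u - F' z0 u * z) has_field_derivative F' z u - F' z0 u) (at z within ?B)"
          by (rule has_field_derivative_at_within)
        have "dist (F' z u) (F' z0 u) < e"
          using d(2)[of "(z0, u)" "(z, u)"] z u r by (auto simp: dist_Pair_Pair dist_commute)
        then show "norm (F' z u - F' z0 u) \<le> e" by (simp add: dist_norm)
      qed (use yB d r in auto)
      then show ?thesis by (simp add: algebra_simps)
    qed
    have ints: "integrable M (F y)" "integrable M (F z0)" "integrable M (F' z0)"
      using contF BS yB assms(2) cont' by auto
    have "(LINT u|M. F y u) - (LINT u|M. F z0 u) - (LINT u|M. F' z0 u) * (y - z0)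
       = (LINT u|M. F y u - F z0 u - F' z0 u * (y - z0))"
      using ints by simp
    also have "norm \<dots> \<le> e * norm (y - z0)"
      using bound BS yB assms(2) by (intro norm_integral_le continuous_intros contF cont') auto
    finally show "norm ((LINT u|M. F y u) - (LINT u|M. F z0 u) - (LINT u|M. F' z0 u) * (y - z0)) \<le> e * norm (y - z0)" .
  qed
qed

end

section \<open>The loop equations\<close>

lemma herm_form_smat: "herm_form v (smat z X) = z * herm_form v X"
  by (simp add: herm_form_def sum_distrib_left mult_ac)

lemma herm_form_diff: "herm_form v (X - Y) = herm_form v X - herm_form v Y"
  by (simp add: herm_form_def sum_subtractf[symmetric] algebra_simps)

lemma continuous_on_herm_form [continuous_intros]:
  "continuous_on S X \<Longrightarrow> continuous_on S (\<lambda>x. herm_form v (X x))"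
  unfolding herm_form_def by (auto intro!: continuous_intros)

lemma sum_mult_axis: "(\<Sum>k\<in>UNIV. f k * axis i (c :: complex) $ k) = f i * c"
proof -
  have "(\<Sum>k\<in>UNIV. f k * axis i c $ k) = (\<Sum>k\<in>UNIV. if k = i then f k * c else 0)"
    by (rule sum.cong) (auto simp: axis_def)
  then show ?thesis by simp
qed

lemma herm_form_axis_add:
  fixes X :: "complex^'n^'n"
  shows "herm_form (axis i 1 + axis j c) X = X $ i $ i + c * X $ i $ j + cnj c * X $ j $ i + cnj c * c * X $ j $ j"
proof -
  have ax: "cnj (axis i c $ k) = axis i (cnj c) $ k" for i k :: 'n and c
    by (simp add: axis_def)
  have "herm_form (axis i 1 + axis j c) X
     = (\<Sum>k\<in>UNIV. (\<Sum>l\<in>UNIV. X $ k $ l * (axis i 1 $ l + axis j c $ l)) * (axis i 1 $ k + axis j (cnj c) $ k))"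
    by (simp only: herm_form_def sum_distrib_right sum_distrib_left vector_add_component complex_cnj_add ax complex_cnj_one mult_ac)
  also have "\<dots> = X $ i $ i + c * X $ i $ j + cnj c * X $ j $ i + cnj c * c * X $ j $ j"
    by (simp only: distrib_left sum.distrib sum_mult_axis) (simp add: algebra_simps)
  finally show ?thesis .
qed

lemma herm_form_axis: "herm_form (axis i 1) X = X $ i $ i"
  using herm_form_axis_add[of i i 0 X] by (simp add: axis_def flip: zero_vec_def)

lemma trace_eq_sum_herm_form: "trace X = (\<Sum>i\<in>UNIV. herm_form (axis i 1) X)"
  by (simp add: trace_def herm_form_axis)

text \<open>The second moment of a random vector, in finite form.  Averaging \<open>v\<^sup>* X v * v\<^sup>* Y v\<close> over
  \<open>v = e\<^sub>i + c e\<^sub>j\<close> with \<open>c\<^sup>4 = 1\<close> leaves the terms that are invariant under \<open>c \<mapsto> \<i> c\<close>; the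
  coordinate vectors then remove the surplus diagonal contribution.\<close>
lemma trace_polarisation:
  fixes X Y :: "complex^'n^'n"
  shows "2 * (trace X * trace Y + trace (X ** Y)) =
    (\<Sum>i\<in>UNIV. \<Sum>j\<in>UNIV. (\<Sum>c\<leftarrow>[1, \<i>, - 1, - \<i>]. herm_form (axis i 1 + axis j c) X * herm_form (axis i 1 + axis j c) Y)) / 4
    - 2 * of_nat CARD('n) * (\<Sum>i\<in>UNIV. herm_form (axis i 1) X * herm_form (axis i 1) Y)"
proof -
  have 1: "(\<Sum>c\<leftarrow>[1, \<i>, - 1, - \<i>]. herm_form (axis i 1 + axis j c) X * herm_form (axis i 1 + axis j c) Y)
    = 4 * ((X $ i $ i + X $ j $ j) * (Y $ i $ i + Y $ j $ j) + X $ i $ j * Y $ j $ i + X $ j $ i * Y $ i $ j)" for i j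
    by (simp add: herm_form_axis_add algebra_simps)
  have 2: "(\<Sum>i\<in>UNIV. \<Sum>j\<in>UNIV. (X $ i $ i + X $ j $ j) * (Y $ i $ i + Y $ j $ j) + X $ i $ j * Y $ j $ i + X $ j $ i * Y $ i $ j)
    = 2 * of_nat CARD('n) * (\<Sum>i\<in>UNIV. X $ i $ i * Y $ i $ i) + 2 * (trace X * trace Y) + 2 * trace (X ** Y)"
  proof -
    have "(\<Sum>i\<in>UNIV. \<Sum>j\<in>UNIV. X $ j $ i * Y $ i $ j) = trace (X ** Y)"
      unfolding trace_def matrix_matrix_mult_def by (subst sum.swap) simp
    moreover have "(\<Sum>i\<in>UNIV. \<Sum>j\<in>UNIV. X $ i $ j * Y $ j $ i) = trace (X ** Y)"
      unfolding trace_def matrix_matrix_mult_def by simp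
    moreover have "(\<Sum>i\<in>UNIV. \<Sum>j\<in>UNIV. X $ i $ i * Y $ j $ j) = trace X * trace Y"
      unfolding trace_def by (simp add: sum_product)
    moreover have "(\<Sum>i\<in>UNIV. \<Sum>j\<in>UNIV. X $ j $ j * Y $ i $ i) = trace X * trace Y"
      unfolding trace_def by (subst sum.swap) (simp add: sum_product)
    ultimately show ?thesis
      by (simp add: distrib_left distrib_right sum.distrib sum_distrib_left[symmetric])
  qed
  show ?thesis
    unfolding 1 herm_form_axis sum_distrib_left[symmetric] 2 by (simp add: field_simps)
qed

definition char_ratio :: "complex \<Rightarrow> complex \<Rightarrow> complex^'n^'n \<Rightarrow> complex" where
  "char_ratio A C X = rcharpoly A X / rcharpoly C X"

text \<open>Its trace is the derivative of \<open>log (char_ratio (z * A) (z * C) X)\<close> at \<open>z = 1\<close>.\<close>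
definition radial :: "complex \<Rightarrow> complex \<Rightarrow> complex^'n^'n \<Rightarrow> complex^'n^'n" where
  "radial A C X = smat C (resolvent C X) - smat A (resolvent A X)"

lemma continuous_on_smat [continuous_intros]:
  "continuous_on S a \<Longrightarrow> continuous_on S X \<Longrightarrow> continuous_on S (\<lambda>x. smat (a x) (X x))"
  unfolding map_matrix_def by (auto intro!: continuous_intros)

lemma continuous_on_char_ratio [continuous_intros]:
  assumes "continuous_on S a" "continuous_on S b" "continuous_on S X" "\<And>x. x \<in> S \<Longrightarrow> rcharpoly (b x) (X x) \<noteq> 0"
  shows "continuous_on S (\<lambda>x. char_ratio (a x) (b x) (X x))"
  unfolding char_ratio_def by (intro continuous_on_divide continuous_on_rcharpoly assms) (use assms in auto)

lemma continuous_on_radial [continuous_intros]: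
  assumes "continuous_on S a" "continuous_on S b" "continuous_on S X" "\<And>x. x \<in> S \<Longrightarrow> rcharpoly (a x) (X x) \<noteq> 0"
   "\<And>x. x \<in> S \<Longrightarrow> rcharpoly (b x) (X x) \<noteq> 0"
  shows "continuous_on S (\<lambda>x. radial (a x) (b x) (X x))"
  unfolding radial_def by (intro continuous_intros assms)

lemma char_ratio_mult_reflection:
  assumes "rcharpoly A X \<noteq> 0" "rcharpoly C X \<noteq> 0"
  shows "char_ratio A C (X ** reflection v \<zeta>) =
    char_ratio A C X * ((1 - \<zeta> * (A * herm_form v (resolvent A X))) / (1 - \<zeta> * (C * herm_form v (resolvent C X))))"
  using assms by (simp add: char_ratio_def rcharpoly_mult_reflection mult.assoc)

lemma eq_at_0_if_eq_right:
  fixes G H :: "real \<Rightarrow> complex"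
  assumes "continuous_on {0..1} G" "continuous_on {0..1} H" "\<And>x. 0 < x \<Longrightarrow> G x = H x"
  shows "G 0 = H 0"
proof -
  have cl: "closure {0<..1} = {0..1::real}" by (rule closure_greaterThanAtMost) simp
  define d where "d x = G x - H x" for x
  have "continuous_on (closure {0<..1}) d"
    unfolding cl d_def by (intro continuous_intros assms)
  then have "d 0 = 0"
    by (rule continuous_constant_on_closure) (use assms(3) in \<open>auto simp: d_def cl\<close>)
  then show ?thesis by (simp add: d_def)
qed

text \<open>Cayley parametrisation of the \<open>\<zeta>\<close> with \<open>1 + |v|\<^sup>2 \<zeta>\<close> on the unit circle.  At \<open>v = 0\<close>
  this circle becomes a line through 0, so no case distinction on \<open>v\<close> arises.\<close>
definition cayley :: "complex^'n \<Rightarrow> real \<Rightarrow> complex" where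
  "cayley v x = of_real x / (\<i> - of_real ((norm v)\<^sup>2 * x / 2))"

lemma cayley_denom: "\<i> \<noteq> complex_of_real y"
  by (simp add: complex_eq_iff)

lemma cayley_0 [simp]: "cayley v 0 = 0"
  by (simp add: cayley_def)

lemma cayley_eq_0_iff: "cayley v x = 0 \<longleftrightarrow> x = 0"
  using cayley_denom[of "(norm v)\<^sup>2 * x / 2"] by (simp add: cayley_def)

lemma continuous_on_cayley [continuous_intros]:
  "continuous_on S a \<Longrightarrow> continuous_on S (\<lambda>x. cayley v (a x))"
  unfolding cayley_def
  by (intro continuous_intros; simp add: cayley_denom del: of_real_divide of_real_mult)

lemma reflection_cayley_unitary: "reflection v (cayley v x) \<in> unitary_group"
proof (rule reflection_unitary)
  define y where "y = (norm v)\<^sup>2 * x / 2"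
  have nz: "\<i> - complex_of_real y \<noteq> 0" "- \<i> - complex_of_real y \<noteq> 0"
    by (simp_all add: complex_eq_iff)
  have c: "cayley v x = of_real x / (\<i> - of_real y)" "cnj (cayley v x) = of_real x / (- \<i> - of_real y)"
    by (simp_all add: cayley_def y_def)
  have m: "complex_of_real ((norm v)\<^sup>2) * of_real x = 2 * of_real y" by (simp add: y_def)
  have e: "c / a + c / b + m * (c / a) * (c / b) = c * (a + b + m * c) / (a * b)"
    if "a \<noteq> 0" "b \<noteq> 0" for a b c m :: complex
    using that by (simp add: field_simps)
  show "cayley v x + cnj (cayley v x) + of_real ((norm v)\<^sup>2) * cayley v x * cnj (cayley v x) = 0"
    unfolding c(2) unfolding c(1) e[OF nz] m by simp
qed

lemma reflection_denominator_nonzero: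
  assumes "norm z \<noteq> 1" "u \<in> unitary_group"
  shows "1 - cayley v x * (z * herm_form v (resolvent z u)) \<noteq> 0"
proof
  assume "1 - cayley v x * (z * herm_form v (resolvent z u)) = 0"
  then have "rcharpoly z (u ** reflection v (cayley v x)) = 0"
    using assms by (simp add: rcharpoly_mult_reflection rcharpoly_unitary_nonzero mult.assoc)
  moreover have "u ** reflection v (cayley v x) \<in> unitary_group"
    using assms reflection_cayley_unitary unitary_mult by blast
  ultimately show False using rcharpoly_unitary_nonzero assms(1) by blast
qed

definition integrand :: "complex \<Rightarrow> complex \<Rightarrow> complex \<Rightarrow> complex \<Rightarrow> complex^'n^'n \<Rightarrow> complex" where
  "integrand A B C D u = char_ratio A C u * char_ratio B D (adj u)"

text \<open>Half the quadratic Casimir operator, applied to \<open>char_ratio A C\<close> and divided by it, up to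
  multiples of the Euler operator and of its square.\<close>
definition casimir :: "complex \<Rightarrow> complex \<Rightarrow> complex^'n^'n \<Rightarrow> complex" where
  "casimir A C X = trace (smat C (resolvent C X)) * trace (radial A C X) + trace (smat C (resolvent C X) ** radial A C X)"

context haar
begin

lemma continuous_on_integrand:
  assumes "norm C \<noteq> 1" "norm D \<noteq> 1"
  shows "continuous_on unitary_group (integrand A B C D)"
  unfolding integrand_def using assms
  by (intro continuous_intros rcharpoly_unitary_nonzero) (auto intro: unitary_adj)

text \<open>Left invariance by \<open>g\<close>, applied to a function in which the factor of \<open>adj u\<close> absorbs one
  \<open>g\<close>: the perturbation may be moved from the factor of \<open>u\<close> to that of \<open>adj u\<close>, with the same
  parameter \<open>\<zeta>\<close> on both sides.\<close>
lemma expectation_reflection: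
  assumes nz: "norm A \<noteq> 1" "norm B \<noteq> 1" "norm C \<noteq> 1" "norm D \<noteq> 1"
    and g: "reflection v \<zeta> \<in> unitary_group"
  shows "(LINT u|M. integrand A B C D u * ((1 - \<zeta> * (A * herm_form v (resolvent A u))) / (1 - \<zeta> * (C * herm_form v (resolvent C u)))))
       = (LINT u|M. integrand A B C D u * ((1 - \<zeta> * (B * herm_form v (resolvent B (adj u)))) / (1 - \<zeta> * (D * herm_form v (resolvent D (adj u))))))"
proof -
  let ?g = "reflection v \<zeta>"
  define F where "F u = char_ratio A C u * char_ratio B D (adj u ** ?g)" for u
  have "continuous_on unitary_group F"
    unfolding F_def using nz g
    by (intro continuous_intros rcharpoly_unitary_nonzero) (auto intro: unitary_adj unitary_mult)
  from integral_left_invariant[OF g this]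
  have "(LINT u|M. F (?g ** u)) = (LINT u|M. F u)" .
  also have "(LINT u|M. F (?g ** u)) = (LINT u|M. char_ratio A C (u ** ?g) * char_ratio B D (adj u))"
  proof (rule integral_cong_M)
    fix u :: "complex^'n^'n"
    have "char_ratio A C (?g ** u) = char_ratio A C (u ** ?g)"
      by (simp add: char_ratio_def rcharpoly_mult_commute[OF g])
    moreover have "adj (?g ** u) ** ?g = adj u"
      using g by (simp add: adj_mult unitary_iff flip: matrix_mul_assoc)
    ultimately show "F (?g ** u) = char_ratio A C (u ** ?g) * char_ratio B D (adj u)"
      by (simp add: F_def)
  qed
  finally have "(LINT u|M. char_ratio A C (u ** ?g) * char_ratio B D (adj u)) = (LINT u|M. F u)" .
  moreover have "(LINT u|M. char_ratio A C (u ** ?g) * char_ratio B D (adj u))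
    = (LINT u|M. integrand A B C D u * ((1 - \<zeta> * (A * herm_form v (resolvent A u))) / (1 - \<zeta> * (C * herm_form v (resolvent C u)))))"
    using nz by (intro integral_cong_M) (simp add: integrand_def char_ratio_mult_reflection rcharpoly_unitary_nonzero mult_ac)
  moreover have "(LINT u|M. F u)
    = (LINT u|M. integrand A B C D u * ((1 - \<zeta> * (B * herm_form v (resolvent B (adj u)))) / (1 - \<zeta> * (D * herm_form v (resolvent D (adj u))))))"
    using nz by (intro integral_cong_M) (simp add: F_def integrand_def char_ratio_mult_reflection rcharpoly_unitary_nonzero unitary_adj mult_ac)
  ultimately show ?thesis by simp
qed

text \<open>The coefficients of \<open>\<zeta>\<close> and \<open>\<zeta>\<^sup>2\<close> in \<open>expectation_reflection\<close>.  Only \<open>\<zeta>\<close> on a circle through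
  0 is available, so they are extracted by dividing by \<open>\<zeta>\<close> and letting \<open>\<zeta>\<close> tend to 0 along the
  circle, twice.\<close>
lemma loop_vector:
  assumes nz: "norm A \<noteq> 1" "norm B \<noteq> 1" "norm C \<noteq> 1" "norm D \<noteq> 1"
  shows loop_first_vector: "(LINT u|M. integrand A B C D u * herm_form v (radial A C u)) = (LINT u|M. integrand A B C D u * herm_form v (radial B D (adj u)))"
    and loop_second_vector: "(LINT u|M. integrand A B C D u * (herm_form v (smat C (resolvent C u)) * herm_form v (radial A C u)))
      = (LINT u|M. integrand A B C D u * (herm_form v (smat D (resolvent D (adj u))) * herm_form v (radial B D (adj u))))"
proof -
  define F :: "complex^'n^'n \<Rightarrow> complex" where "F = integrand A B C D"
  have F: "continuous_on unitary_group F" unfolding F_def by (rule continuous_on_integrand[OF nz(3,4)])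
  define \<zeta> where "\<zeta> = cayley v"
  define p q p' q' where "p u = A * herm_form v (resolvent A u)" and "q u = C * herm_form v (resolvent C u)"
    and "p' u = B * herm_form v (resolvent B (adj u))" and "q' u = D * herm_form v (resolvent D (adj u))" for u :: "complex^'n^'n"
  have cont: "continuous_on unitary_group p" "continuous_on unitary_group q"
     "continuous_on unitary_group p'" "continuous_on unitary_group q'"
    unfolding p_def q_def p'_def q'_def using nz
    by (auto intro!: continuous_intros simp: rcharpoly_unitary_nonzero unitary_adj)
  have den: "1 - \<zeta> x * q u \<noteq> 0" "1 - \<zeta> x * q' u \<noteq> 0" if "u \<in> unitary_group" for x u
    unfolding \<zeta>_def q_def q'_def using reflection_denominator_nonzero nz that unitary_adj by blast+
  have snd: "continuous_on ({0..1} \<times> unitary_group) (\<lambda>p. f (snd p))" if "continuous_on unitary_group f"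
    for f :: "complex^'n^'n \<Rightarrow> complex"
    by (rule continuous_on_compose2[OF that continuous_on_snd[OF continuous_on_id]]) auto
  have G: "continuous_on {0..1} (\<lambda>x. LINT u|M. F u * (h u / (1 - \<zeta> x * k u)))"
    if "continuous_on unitary_group h" "continuous_on unitary_group k"
     "\<And>x u. u \<in> unitary_group \<Longrightarrow> 1 - \<zeta> x * k u \<noteq> 0" for h k
  proof (rule continuous_on_integral)
    show "continuous_on ({0..1} \<times> unitary_group) (\<lambda>p. F (snd p) * (h (snd p) / (1 - \<zeta> (fst p) * k (snd p))))"
      unfolding \<zeta>_def by (intro continuous_intros snd F that) (use that(3) in \<open>auto simp: \<zeta>_def\<close>)
  qed simp
  have I: "integrable M (\<lambda>u. F u * (h u / (1 - \<zeta> x * k u)))" "integrable M (\<lambda>u. F u * h u)"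
    if "continuous_on unitary_group h" "continuous_on unitary_group k"
     "\<And>x u. u \<in> unitary_group \<Longrightarrow> 1 - \<zeta> x * k u \<noteq> 0" for h k x
    by (intro integrable_M continuous_intros F that; use that in auto)+
  have base: "(LINT u|M. F u * ((1 - \<zeta> x * p u) / (1 - \<zeta> x * q u))) = (LINT u|M. F u * ((1 - \<zeta> x * p' u) / (1 - \<zeta> x * q' u)))" for x
    unfolding F_def p_def q_def p'_def q'_def \<zeta>_def
    by (rule expectation_reflection[OF nz reflection_cayley_unitary])
  have expand: "(LINT u|M. F u * ((1 - \<zeta> x * p u) / (1 - \<zeta> x * q u)))
      = (LINT u|M. F u) + \<zeta> x * (LINT u|M. F u * ((q u - p u) / (1 - \<zeta> x * q u)))"
    if "continuous_on unitary_group p" "continuous_on unitary_group q"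
     "\<And>x u. u \<in> unitary_group \<Longrightarrow> 1 - \<zeta> x * q u \<noteq> 0" for x p q
  proof -
    have "(LINT u|M. F u * ((1 - \<zeta> x * p u) / (1 - \<zeta> x * q u)))
       = (LINT u|M. F u + \<zeta> x * (F u * ((q u - p u) / (1 - \<zeta> x * q u))))"
      using that(3) by (intro integral_cong_M) (simp add: field_simps)
    also have "\<dots> = (LINT u|M. F u) + (LINT u|M. \<zeta> x * (F u * ((q u - p u) / (1 - \<zeta> x * q u))))"
      by (intro Bochner_Integration.integral_add integrable_M F integrable_mult_right I continuous_intros that)
    finally show ?thesis unfolding integral_mult_right_zero .
  qed
  have 1: "(LINT u|M. F u * ((q u - p u) / (1 - \<zeta> x * q u))) = (LINT u|M. F u * ((q' u - p' u) / (1 - \<zeta> x * q' u)))"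
    if "0 \<le> x" for x
  proof -
    have *: "(LINT u|M. F u * ((q u - p u) / (1 - \<zeta> x * q u))) = (LINT u|M. F u * ((q' u - p' u) / (1 - \<zeta> x * q' u)))"
      if "0 < x" for x
    proof -
      have "\<zeta> x \<noteq> 0" using that by (simp add: \<zeta>_def cayley_eq_0_iff)
      with trans[OF trans[OF expand[OF cont(1,2) den(1), symmetric] base] expand[OF cont(3,4) den(2)], of x]
      show ?thesis by simp
    qed
    have "(LINT u|M. F u * ((q u - p u) / (1 - \<zeta> 0 * q u))) = (LINT u|M. F u * ((q' u - p' u) / (1 - \<zeta> 0 * q' u)))"
      by (rule eq_at_0_if_eq_right[OF G G *]) (intro continuous_intros cont den; assumption)+
    with * that show ?thesis by (cases "x = 0") auto
  qed
  have expand2: "(LINT u|M. F u * ((q u - p u) / (1 - \<zeta> x * q u)))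
      = (LINT u|M. F u * (q u - p u)) + \<zeta> x * (LINT u|M. F u * ((q u * (q u - p u)) / (1 - \<zeta> x * q u)))"
    if "continuous_on unitary_group p" "continuous_on unitary_group q"
     "\<And>x u. u \<in> unitary_group \<Longrightarrow> 1 - \<zeta> x * q u \<noteq> 0" for x p q
  proof -
    have "(LINT u|M. F u * ((q u - p u) / (1 - \<zeta> x * q u)))
       = (LINT u|M. F u * (q u - p u) + \<zeta> x * (F u * ((q u * (q u - p u)) / (1 - \<zeta> x * q u))))"
      using that(3) by (intro integral_cong_M) (simp add: field_simps)
    also have "\<dots> = (LINT u|M. F u * (q u - p u)) + (LINT u|M. \<zeta> x * (F u * ((q u * (q u - p u)) / (1 - \<zeta> x * q u))))"
      by (intro Bochner_Integration.integral_add integrable_M F integrable_mult_right I continuous_intros that)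
    finally show ?thesis unfolding integral_mult_right_zero .
  qed
  have 2: "(LINT u|M. F u * (q u - p u)) = (LINT u|M. F u * (q' u - p' u))"
    using 1[of 0] by (simp add: \<zeta>_def)
  have *: "(LINT u|M. F u * ((q u * (q u - p u)) / (1 - \<zeta> x * q u))) = (LINT u|M. F u * ((q' u * (q' u - p' u)) / (1 - \<zeta> x * q' u)))"
    if "0 < x" for x
  proof -
    have "\<zeta> x \<noteq> 0" using that by (simp add: \<zeta>_def cayley_eq_0_iff)
    with trans[OF trans[OF expand2[OF cont(1,2) den(1), symmetric] 1] expand2[OF cont(3,4) den(2)], of x] 2 that
    show ?thesis by simp
  qed
  have "(LINT u|M. F u * ((q u * (q u - p u)) / (1 - \<zeta> 0 * q u))) = (LINT u|M. F u * ((q' u * (q' u - p' u)) / (1 - \<zeta> 0 * q' u)))"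
    by (rule eq_at_0_if_eq_right[OF G G *]) (intro continuous_intros cont den; assumption)+
  then have 3: "(LINT u|M. F u * (q u * (q u - p u))) = (LINT u|M. F u * (q' u * (q' u - p' u)))"
    by (simp add: \<zeta>_def)
  show "(LINT u|M. integrand A B C D u * herm_form v (radial A C u)) = (LINT u|M. integrand A B C D u * herm_form v (radial B D (adj u)))"
    using 2 by (simp add: F_def p_def q_def p'_def q'_def radial_def herm_form_diff herm_form_smat)
  show "(LINT u|M. integrand A B C D u * (herm_form v (smat C (resolvent C u)) * herm_form v (radial A C u)))
      = (LINT u|M. integrand A B C D u * (herm_form v (smat D (resolvent D (adj u))) * herm_form v (radial B D (adj u))))"
    using 3 by (simp add: F_def p_def q_def p'_def q'_def radial_def herm_form_diff herm_form_smat)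
qed

text \<open>The vectors of the standard basis turn the quadratic forms of \<open>loop_first_vector\<close> into traces.\<close>
lemma loop_first:
  assumes "norm A \<noteq> 1" "norm B \<noteq> 1" "norm C \<noteq> 1" "norm D \<noteq> 1"
  shows "(LINT u|M. integrand A B C D u * trace (radial A C u)) = (LINT u|M. integrand A B C D u * trace (radial B D (adj u)))"
proof -
  have expand: "(LINT u|M. integrand A B C D u * trace (X u)) = (\<Sum>i\<in>UNIV. LINT u|M. integrand A B C D u * herm_form (axis i 1) (X u))"
    if "continuous_on unitary_group X" for X :: "complex^'n^'n \<Rightarrow> complex^'n^'n"
    unfolding trace_eq_sum_herm_form sum_distrib_left
    by (intro Bochner_Integration.integral_sum integrable_M continuous_intros continuous_on_integrand assms that)
  have cont: "continuous_on unitary_group (radial A C)" "continuous_on unitary_group (\<lambda>u. radial B D (adj u))"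
    using assms by (auto intro!: continuous_intros simp: rcharpoly_unitary_nonzero unitary_adj)
  show ?thesis
    by (simp only: expand[OF cont(1)] expand[OF cont(2)] loop_first_vector[OF assms])
qed

text \<open>Polarisation, by means of \<open>trace_polarisation\<close>, of \<open>loop_second_vector\<close>.\<close>
lemma loop_second:
  assumes "norm A \<noteq> 1" "norm B \<noteq> 1" "norm C \<noteq> 1" "norm D \<noteq> 1"
  shows "(LINT u|M. integrand A B C D u * casimir A C u) = (LINT u|M. integrand A B C D u * casimir B D (adj u))"
proof -
  define J where "J X Y v = (LINT u|M. integrand A B C D u * (herm_form v (X u) * herm_form v (Y u)))" for X Y :: "complex^'n^'n \<Rightarrow> complex^'n^'n" and v
  have "(LINT u|M. integrand A B C D u * (trace (X u) * trace (Y u) + trace (X u ** Y u))) =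
     ((\<Sum>i\<in>UNIV. \<Sum>j\<in>UNIV. (\<Sum>c\<leftarrow>[1, \<i>, - 1, - \<i>]. J X Y (axis i 1 + axis j c))) / 4
    - 2 * of_nat CARD('n) * (\<Sum>i\<in>UNIV. J X Y (axis i 1))) / 2"
    if "continuous_on unitary_group X" "continuous_on unitary_group Y" for X Y :: "complex^'n^'n \<Rightarrow> complex^'n^'n"
  proof -
    have int: "integrable M (\<lambda>u. integrand A B C D u * (herm_form v (X u) * herm_form v (Y u)))" for v
      by (intro integrable_M continuous_intros continuous_on_integrand assms that)
    have "(LINT u|M. integrand A B C D u * (trace (X u) * trace (Y u) + trace (X u ** Y u)))
      = (LINT u|M. ((\<Sum>i\<in>UNIV. \<Sum>j\<in>UNIV. (\<Sum>c\<leftarrow>[1, \<i>, - 1, - \<i>]. integrand A B C D u * (herm_form (axis i 1 + axis j c) (X u) * herm_form (axis i 1 + axis j c) (Y u)))) / 4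
       - 2 * of_nat CARD('n) * (\<Sum>i\<in>UNIV. integrand A B C D u * (herm_form (axis i 1) (X u) * herm_form (axis i 1) (Y u)))) / 2)"
    proof (rule integral_cong_M)
      fix u :: "complex^'n^'n"
      have "integrand A B C D u * (trace (X u) * trace (Y u) + trace (X u ** Y u))
        = integrand A B C D u * (2 * (trace (X u) * trace (Y u) + trace (X u ** Y u))) / 2" by simp
      also have "\<dots> = ((\<Sum>i\<in>UNIV. \<Sum>j\<in>UNIV. (\<Sum>c\<leftarrow>[1, \<i>, - 1, - \<i>]. integrand A B C D u * (herm_form (axis i 1 + axis j c) (X u) * herm_form (axis i 1 + axis j c) (Y u)))) / 4
       - 2 * of_nat CARD('n) * (\<Sum>i\<in>UNIV. integrand A B C D u * (herm_form (axis i 1) (X u) * herm_form (axis i 1) (Y u)))) / 2"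
        unfolding trace_polarisation
        by (simp add: sum_distrib_left distrib_left right_diff_distrib mult_ac)
      finally show "integrand A B C D u * (trace (X u) * trace (Y u) + trace (X u ** Y u)) = \<dots>" .
    qed
    then show ?thesis
      using int by (simp add: J_def)
  qed
  note expand = this
  have cont: "continuous_on unitary_group (radial A C)" "continuous_on unitary_group (\<lambda>u. radial B D (adj u))"
    "continuous_on unitary_group (\<lambda>u. smat C (resolvent C u))" "continuous_on unitary_group (\<lambda>u. smat D (resolvent D (adj u)))"
    using assms by (auto intro!: continuous_intros simp: rcharpoly_unitary_nonzero unitary_adj)
  have "J (\<lambda>u. smat C (resolvent C u)) (radial A C) v = J (\<lambda>u. smat D (resolvent D (adj u))) (\<lambda>u. radial B D (adj u)) v" for v
    unfolding J_def by (rule loop_second_vector[OF assms])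
  then show ?thesis
    unfolding casimir_def by (simp only: expand[OF cont(3,1)] expand[OF cont(4,2)])
qed

end

section \<open>Differentiation in the parameters\<close>

lemma DERIV_trace_resolvent:
  assumes "rcharpoly z X \<noteq> 0"
  shows "((\<lambda>z. trace (resolvent z X)) has_field_derivative trace (resolvent z X ** resolvent z X)) (at z)"
  unfolding has_field_derivative_iff
proof (rule Lim_transform_eventually)
  have "isCont (\<lambda>w. trace (resolvent w X ** resolvent z X)) z"
  proof -
    have "open {w. rcharpoly w X \<noteq> 0}"
      by (intro open_Collect_neq continuous_intros)
    moreover have "continuous_on {w. rcharpoly w X \<noteq> 0} (\<lambda>w. trace (resolvent w X ** resolvent z X))"
      by (intro continuous_intros) auto
    ultimately show ?thesis using assms by (simp add: continuous_on_eq_continuous_at)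
  qed
  then show "((\<lambda>w. trace (resolvent w X ** resolvent z X)) \<longlongrightarrow> trace (resolvent z X ** resolvent z X)) (at z)"
    by (simp add: isCont_def)
  have "\<forall>\<^sub>F w in at z. w \<in> {w. rcharpoly w X \<noteq> 0}"
    using assms by (intro eventually_at_in_open') (auto intro!: open_Collect_neq continuous_intros)
  moreover have "\<forall>\<^sub>F w in at z. w \<noteq> z" by (rule eventually_neq_at_within)
  ultimately show "\<forall>\<^sub>F w in at z. trace (resolvent w X ** resolvent z X) = (trace (resolvent w X) - trace (resolvent z X)) / (w - z)"
  proof eventually_elim
    case (elim w)
    then show ?case using trace_resolvent_mult[of w X z] assms by (simp add: field_simps)
  qed
qed

lemma DERIV_char_ratio_right:
  assumes "rcharpoly z X \<noteq> 0"
  shows "((\<lambda>z. char_ratio A z X) has_field_derivative char_ratio A z X * trace (resolvent z X)) (at z)"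
  unfolding char_ratio_def
  by (rule derivative_eq_intros DERIV_rcharpoly refl assms)+ (use assms in \<open>simp add: rcharpoly'_eq field_simps\<close>)

lemma trace_radial: "trace (radial A C X) = C * trace (resolvent C X) - A * trace (resolvent A X)"
  by (simp add: radial_def trace_sub trace_smat)

lemma DERIV_char_ratio_radial:
  assumes "rcharpoly (z * A) X \<noteq> 0" "rcharpoly (z * C) X \<noteq> 0"
  shows "((\<lambda>z. char_ratio (z * A) (z * C) X) has_field_derivative
     char_ratio (z * A) (z * C) X * (C * trace (resolvent (z * C) X) - A * trace (resolvent (z * A) X))) (at z)"
proof -
  have a: "((\<lambda>z. rcharpoly (z * A) X) has_field_derivative rcharpoly' (z * A) X * A) (at z)"
    by (rule DERIV_chain2[where g = "\<lambda>z. z * A", OF DERIV_rcharpoly]) (auto intro!: derivative_eq_intros)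
  have c: "((\<lambda>z. rcharpoly (z * C) X) has_field_derivative rcharpoly' (z * C) X * C) (at z)"
    by (rule DERIV_chain2[where g = "\<lambda>z. z * C", OF DERIV_rcharpoly]) (auto intro!: derivative_eq_intros)
  show ?thesis
    unfolding char_ratio_def
    by (rule DERIV_cong[OF DERIV_divide[OF a c]]) (use assms in \<open>simp_all add: rcharpoly'_eq field_simps\<close>)
qed

text \<open>On the left stands \<open>C \<partial>\<^sub>C\<close> of \<open>char_ratio A C X * trace (radial A C X)\<close>, divided by
  \<open>char_ratio A C X\<close>.  The only term of \<open>casimir\<close> that is not a derivative in \<open>C\<close> alone is the trace of a
  product of two resolvents, which the resolvent identity reduces to single traces.\<close>
lemma casimir_identity:
  assumes "rcharpoly A X \<noteq> 0" "rcharpoly C X \<noteq> 0" "C \<noteq> A"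
  shows "C * (trace (resolvent C X) * trace (radial A C X) + trace (resolvent C X) + C * trace (resolvent C X ** resolvent C X))
       = casimir A C X + C / (C - A) * trace (radial A C X)"
proof -
  define x where "x = trace (resolvent C X ** resolvent A X)"
  have x: "x = (trace (resolvent C X) - trace (resolvent A X)) / (C - A)"
    using trace_resolvent_mult[OF assms(2,1)] assms(3) by (simp add: x_def field_simps)
  have "casimir A C X = C * trace (resolvent C X) * trace (radial A C X) + C * C * trace (resolvent C X ** resolvent C X) - C * A * x"
    by (simp add: casimir_def radial_def matrix_diff_ldistrib smat_mult_left smat_mult_right trace_sub trace_smat x_def algebra_simps)
  then show ?thesis
    using assms(3) unfolding x trace_radial by (simp add: field_simps)
qed

text \<open>\<open>1 - c u = - c u (1 - u\<^sup>* / c)\<close>.\<close>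
lemma rcharpoly_reciprocal:
  fixes u :: "complex^'n^'n"
  assumes "u \<in> unitary_group" "c \<noteq> 0"
  shows "rcharpoly c u = (- c) ^ CARD('n) * det u * rcharpoly (1 / c) (adj u)"
proof -
  have "mat 1 - smat c u = smat (- c) (u ** (mat 1 - smat (1 / c) (adj u)))"
    using assms by (simp add: matrix_diff_ldistrib smat_mult_right unitary_iff) (simp add: vec_eq_iff algebra_simps)
  then show ?thesis by (simp add: rcharpoly_def det_smat det_mul)
qed

context haar
begin

abbreviation ratio_mean where "ratio_mean A B C D \<equiv> (LINT u|M. integrand A B C D u)"
abbreviation radial_mean where "radial_mean A B C D \<equiv> (LINT u|M. integrand A B C D u * trace (radial A C u))"

lemma rcharpoly_nonzero: "norm z < 1 \<Longrightarrow> u \<in> unitary_group \<Longrightarrow> rcharpoly z u \<noteq> 0"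
  by (rule rcharpoly_unitary_nonzero) auto

lemma rcharpoly_adj_nonzero: "norm z < 1 \<Longrightarrow> u \<in> unitary_group \<Longrightarrow> rcharpoly z (adj u) \<noteq> 0"
  using rcharpoly_nonzero unitary_adj by blast

text \<open>Both sides are derivatives in \<open>D\<close> of the two sides of \<open>loop_first\<close>.\<close>
lemma loop_first_deriv:
  assumes "norm A \<noteq> 1" "norm B \<noteq> 1" "norm C < 1" "norm D < 1"
  shows "(LINT u|M. integrand A B C D u * trace (resolvent D (adj u)) * trace (radial A C u))
    = (LINT u|M. integrand A B C D u * (trace (resolvent D (adj u)) * trace (radial B D (adj u)) + trace (resolvent D (adj u)) + D * trace (resolvent D (adj u) ** resolvent D (adj u))))"
proof (rule DERIV_unique)
  let ?S = "ball (0::complex) 1"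
  have nz: "\<And>u. u \<in> unitary_group \<Longrightarrow> rcharpoly A u \<noteq> 0" "\<And>u. u \<in> unitary_group \<Longrightarrow> rcharpoly B (adj u) \<noteq> 0"
     "\<And>u. u \<in> unitary_group \<Longrightarrow> rcharpoly C u \<noteq> 0" "\<And>z u. norm z < 1 \<Longrightarrow> u \<in> unitary_group \<Longrightarrow> rcharpoly z (adj u) \<noteq> 0"
    using assms rcharpoly_unitary_nonzero rcharpoly_nonzero rcharpoly_adj_nonzero unitary_adj by blast+
  show "((\<lambda>D. LINT u|M. integrand A B C D u * trace (radial A C u)) has_field_derivative
     (LINT u|M. integrand A B C D u * trace (resolvent D (adj u)) * trace (radial A C u))) (at D)"
  proof (rule DERIV_integral[where S = ?S])
    show "continuous_on (?S \<times> unitary_group)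
      (\<lambda>p. integrand A B C (fst p) (snd p) * trace (resolvent (fst p) (adj (snd p))) * trace (radial A C (snd p)))"
      unfolding integrand_def by (auto intro!: continuous_intros simp: nz)
    show "continuous_on unitary_group (\<lambda>u. integrand A B C z u * trace (radial A C u))" if "z \<in> ?S" for z
      using that unfolding integrand_def by (auto intro!: continuous_intros simp: nz)
    show "((\<lambda>z. integrand A B C z u * trace (radial A C u)) has_field_derivative
       integrand A B C z u * trace (resolvent z (adj u)) * trace (radial A C u)) (at z)"
      if "z \<in> ?S" "u \<in> unitary_group" for z u
      unfolding integrand_def by (rule derivative_eq_intros DERIV_char_ratio_right refl nz)+ (use that in auto)
  qed (use assms in auto)
  have "((\<lambda>D. LINT u|M. integrand A B C D u * trace (radial B D (adj u))) has_field_derivative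
     (LINT u|M. integrand A B C D u * (trace (resolvent D (adj u)) * trace (radial B D (adj u)) + trace (resolvent D (adj u)) + D * trace (resolvent D (adj u) ** resolvent D (adj u))))) (at D)"
  proof (rule DERIV_integral[where S = ?S])
    show "continuous_on (?S \<times> unitary_group)
      (\<lambda>p. integrand A B C (fst p) (snd p) * (trace (resolvent (fst p) (adj (snd p))) * trace (radial B (fst p) (adj (snd p)))
         + trace (resolvent (fst p) (adj (snd p))) + fst p * trace (resolvent (fst p) (adj (snd p)) ** resolvent (fst p) (adj (snd p)))))"
      unfolding integrand_def by (auto intro!: continuous_intros simp: nz)
    show "continuous_on unitary_group (\<lambda>u. integrand A B C z u * trace (radial B z (adj u)))" if "z \<in> ?S" for z
      using that unfolding integrand_def by (auto intro!: continuous_intros simp: nz)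
    show "((\<lambda>z. integrand A B C z u * trace (radial B z (adj u))) has_field_derivative
       integrand A B C z u * (trace (resolvent z (adj u)) * trace (radial B z (adj u)) + trace (resolvent z (adj u)) + z * trace (resolvent z (adj u) ** resolvent z (adj u)))) (at z)"
      if "z \<in> ?S" "u \<in> unitary_group" for z u
    proof -
      have z: "rcharpoly z (adj u) \<noteq> 0" using that nz(4) by simp
      have "((\<lambda>z. z * trace (resolvent z (adj u)) - B * trace (resolvent B (adj u))) has_field_derivative
         trace (resolvent z (adj u)) + z * trace (resolvent z (adj u) ** resolvent z (adj u))) (at z)"
        using DERIV_trace_resolvent[OF z] by (auto intro!: derivative_eq_intros)
      from DERIV_mult[OF DERIV_cmult[OF DERIV_char_ratio_right[OF z], of "char_ratio A C u"] this]
      show ?thesis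
        unfolding integrand_def trace_radial by (rule DERIV_cong) (simp add: algebra_simps)
    qed
  qed (use assms in auto)
  then show "((\<lambda>D. LINT u|M. integrand A B C D u * trace (radial A C u)) has_field_derivative
     (LINT u|M. integrand A B C D u * (trace (resolvent D (adj u)) * trace (radial B D (adj u)) + trace (resolvent D (adj u)) + D * trace (resolvent D (adj u) ** resolvent D (adj u))))) (at D)"
    by (rule has_field_derivative_transform_within_open[where S = ?S])
       (use assms in \<open>auto intro!: loop_first[symmetric]\<close>)
qed

text \<open>The Casimir terms of the two sides cancel by \<open>loop_second\<close>, which leaves only the corrections
  from \<open>casimir_identity\<close>.\<close>
lemma casimir_moment:
  assumes "norm A \<noteq> 1" "norm B \<noteq> 1" "norm C < 1" "norm D < 1" "C \<noteq> A" "D \<noteq> B"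
  shows "C * (LINT u|M. integrand A B C D u * (trace (resolvent C u) * trace (radial A C u) + trace (resolvent C u) + C * trace (resolvent C u ** resolvent C u)))
       - D * (LINT u|M. integrand A B C D u * (trace (resolvent D (adj u)) * trace (radial B D (adj u)) + trace (resolvent D (adj u)) + D * trace (resolvent D (adj u) ** resolvent D (adj u))))
       = (C / (C - A) - D / (D - B)) * radial_mean A B C D"
proof -
  have nz: "\<And>u. u \<in> unitary_group \<Longrightarrow> rcharpoly A u \<noteq> 0" "\<And>u. u \<in> unitary_group \<Longrightarrow> rcharpoly B (adj u) \<noteq> 0"
     "\<And>u. u \<in> unitary_group \<Longrightarrow> rcharpoly C u \<noteq> 0" "\<And>u. u \<in> unitary_group \<Longrightarrow> rcharpoly D (adj u) \<noteq> 0"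
    using assms rcharpoly_unitary_nonzero rcharpoly_nonzero rcharpoly_adj_nonzero unitary_adj by blast+
  have ne: "norm C \<noteq> 1" "norm D \<noteq> 1" using assms by auto
  have weight: "c * (w * s) = w * x + k * (w * r)" if "c * s = x + k * r" for c s x k r w :: complex
    using that by algebra
  have "C * (LINT u|M. integrand A B C D u * (trace (resolvent C u) * trace (radial A C u) + trace (resolvent C u) + C * trace (resolvent C u ** resolvent C u)))
    = (LINT u|M. integrand A B C D u * casimir A C u + C / (C - A) * (integrand A B C D u * trace (radial A C u)))"
    unfolding integral_mult_right_zero[symmetric]
  proof (rule integral_cong_M)
    fix u :: "complex^'n^'n" assume "u \<in> unitary_group"
    from casimir_identity[OF nz(1,3)[OF this] assms(5)]
    show "C * (integrand A B C D u * (trace (resolvent C u) * trace (radial A C u) + trace (resolvent C u) + C * trace (resolvent C u ** resolvent C u)))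
      = integrand A B C D u * casimir A C u + C / (C - A) * (integrand A B C D u * trace (radial A C u))"
      by (rule weight)
  qed
  also have "\<dots> = (LINT u|M. integrand A B C D u * casimir A C u) + (LINT u|M. C / (C - A) * (integrand A B C D u * trace (radial A C u)))"
    unfolding casimir_def integrand_def
    by (intro Bochner_Integration.integral_add integrable_mult_right integrable_M; auto intro!: continuous_intros simp: nz)
  finally have 1: "C * (LINT u|M. integrand A B C D u * (trace (resolvent C u) * trace (radial A C u) + trace (resolvent C u) + C * trace (resolvent C u ** resolvent C u)))
     = (LINT u|M. integrand A B C D u * casimir A C u) + C / (C - A) * radial_mean A B C D"
    unfolding integral_mult_right_zero .
  have "D * (LINT u|M. integrand A B C D u * (trace (resolvent D (adj u)) * trace (radial B D (adj u)) + trace (resolvent D (adj u)) + D * trace (resolvent D (adj u) ** resolvent D (adj u))))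
    = (LINT u|M. integrand A B C D u * casimir B D (adj u) + D / (D - B) * (integrand A B C D u * trace (radial B D (adj u))))"
    unfolding integral_mult_right_zero[symmetric]
  proof (rule integral_cong_M)
    fix u :: "complex^'n^'n" assume "u \<in> unitary_group"
    from casimir_identity[OF nz(2,4)[OF this] assms(6)]
    show "D * (integrand A B C D u * (trace (resolvent D (adj u)) * trace (radial B D (adj u)) + trace (resolvent D (adj u)) + D * trace (resolvent D (adj u) ** resolvent D (adj u))))
      = integrand A B C D u * casimir B D (adj u) + D / (D - B) * (integrand A B C D u * trace (radial B D (adj u)))"
      by (rule weight)
  qed
  also have "\<dots> = (LINT u|M. integrand A B C D u * casimir B D (adj u)) + (LINT u|M. D / (D - B) * (integrand A B C D u * trace (radial B D (adj u))))"
    unfolding casimir_def integrand_def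
    by (intro Bochner_Integration.integral_add integrable_mult_right integrable_M; auto intro!: continuous_intros simp: nz)
  finally have 2: "D * (LINT u|M. integrand A B C D u * (trace (resolvent D (adj u)) * trace (radial B D (adj u)) + trace (resolvent D (adj u)) + D * trace (resolvent D (adj u) ** resolvent D (adj u))))
     = (LINT u|M. integrand A B C D u * casimir A C u) + D / (D - B) * radial_mean A B C D"
    unfolding integral_mult_right_zero loop_second[OF assms(1,2) ne] loop_first[OF assms(1,2) ne] .
  show ?thesis unfolding 1 2 by (simp add: algebra_simps)
qed

text \<open>Along \<open>(C t, D / t)\<close> the radial mean has the logarithmic derivative of
  \<open>(C t - A) (D / t - B)\<close>.  The contribution of the second variable is first rewritten by
  \<open>loop_first_deriv\<close>, so that \<open>casimir_moment\<close> applies.\<close>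
lemma DERIV_radial_mean:
  assumes "norm A \<noteq> 1" "norm B \<noteq> 1" "open T" "t \<in> T"
    and T: "\<And>t. t \<in> T \<Longrightarrow> t \<noteq> 0 \<and> norm (C * t) < 1 \<and> norm (D / t) < 1 \<and> C * t \<noteq> A \<and> D / t \<noteq> B"
  shows "((\<lambda>t. radial_mean A B (C * t) (D / t)) has_field_derivative
    (C * t / (C * t - A) - (D / t) / (D / t - B)) * radial_mean A B (C * t) (D / t) / t) (at t)"
proof -
  have nz: "\<And>u. u \<in> unitary_group \<Longrightarrow> rcharpoly A u \<noteq> 0" "\<And>u. u \<in> unitary_group \<Longrightarrow> rcharpoly B (adj u) \<noteq> 0"
     "\<And>t u. t \<in> T \<Longrightarrow> u \<in> unitary_group \<Longrightarrow> rcharpoly (C * t) u \<noteq> 0" "\<And>t u. t \<in> T \<Longrightarrow> u \<in> unitary_group \<Longrightarrow> rcharpoly (D / t) (adj u) \<noteq> 0"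
    using assms rcharpoly_unitary_nonzero rcharpoly_nonzero rcharpoly_adj_nonzero unitary_adj by blast+
  have T0: "t \<noteq> 0" if "t \<in> T" for t using T that by blast
  define F' where "F' t u = C * (integrand A B (C * t) (D / t) u * (trace (resolvent (C * t) u) * trace (radial A (C * t) u) + trace (resolvent (C * t) u) + C * t * trace (resolvent (C * t) u ** resolvent (C * t) u)))
     - D / t\<^sup>2 * (integrand A B (C * t) (D / t) u * trace (resolvent (D / t) (adj u)) * trace (radial A (C * t) u))" for t and u :: "complex^'n^'n"
  have cont: "continuous_on unitary_group (\<lambda>u. integrand A B (C * t) (D / t) u * (trace (resolvent (C * t) u) * trace (radial A (C * t) u) + trace (resolvent (C * t) u) + C * t * trace (resolvent (C * t) u ** resolvent (C * t) u)))"
    "continuous_on unitary_group (\<lambda>u. integrand A B (C * t) (D / t) u * trace (resolvent (D / t) (adj u)) * trace (radial A (C * t) u))"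
    using assms(4) unfolding integrand_def by (auto intro!: continuous_intros simp: nz)
  have "((\<lambda>t. radial_mean A B (C * t) (D / t)) has_field_derivative (LINT u|M. F' t u)) (at t)"
  proof (rule DERIV_integral[where S = T])
    show "continuous_on (T \<times> unitary_group) (\<lambda>p. F' (fst p) (snd p))"
      unfolding F'_def integrand_def by (auto intro!: continuous_intros simp: nz T0)
    show "continuous_on unitary_group (\<lambda>u. integrand A B (C * z) (D / z) u * trace (radial A (C * z) u))" if "z \<in> T" for z
      using that unfolding integrand_def by (auto intro!: continuous_intros simp: nz)
    show "((\<lambda>z. integrand A B (C * z) (D / z) u * trace (radial A (C * z) u)) has_field_derivative F' z u) (at z)"
      if z: "z \<in> T" and u: "u \<in> unitary_group" for z u
    proof -
      have "((\<lambda>z. char_ratio A (C * z) u) has_field_derivative char_ratio A (C * z) u * trace (resolvent (C * z) u) * C) (at z)"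
        by (rule DERIV_chain2[where g = "\<lambda>z. C * z", OF DERIV_char_ratio_right[OF nz(3)[OF z u]]]) (auto intro!: derivative_eq_intros)
      moreover have "((\<lambda>z. char_ratio B (D / z) (adj u)) has_field_derivative char_ratio B (D / z) (adj u) * trace (resolvent (D / z) (adj u)) * (- D / z\<^sup>2)) (at z)"
        by (rule DERIV_chain2[where g = "\<lambda>z. D / z", OF DERIV_char_ratio_right[OF nz(4)[OF z u]]])
          (use T0[OF z] in \<open>auto intro!: derivative_eq_intros simp: power2_eq_square\<close>)
      moreover have "((\<lambda>z. trace (resolvent (C * z) u)) has_field_derivative trace (resolvent (C * z) u ** resolvent (C * z) u) * C) (at z)"
        by (rule DERIV_chain2[where g = "\<lambda>z. C * z", OF DERIV_trace_resolvent[OF nz(3)[OF z u]]]) (auto intro!: derivative_eq_intros)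
      ultimately show ?thesis
        unfolding integrand_def trace_radial F'_def
        by (auto intro!: derivative_eq_intros simp: algebra_simps)
    qed
  qed (use assms in auto)
  moreover have "(LINT u|M. F' t u) = (C * t / (C * t - A) - (D / t) / (D / t - B)) * radial_mean A B (C * t) (D / t) / t"
  proof -
    have t: "norm (C * t) < 1" "norm (D / t) < 1" "C * t \<noteq> A" "D / t \<noteq> B" "t \<noteq> 0" using T[OF assms(4)] by auto
    have "(LINT u|M. F' t u) =
       C * (LINT u|M. integrand A B (C * t) (D / t) u * (trace (resolvent (C * t) u) * trace (radial A (C * t) u) + trace (resolvent (C * t) u) + C * t * trace (resolvent (C * t) u ** resolvent (C * t) u)))
     - D / t\<^sup>2 * (LINT u|M. integrand A B (C * t) (D / t) u * trace (resolvent (D / t) (adj u)) * trace (radial A (C * t) u))"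
      unfolding F'_def integral_mult_right_zero[symmetric]
      by (intro Bochner_Integration.integral_diff integrable_mult_right integrable_M cont)
    also have "\<dots> = (C * t * (LINT u|M. integrand A B (C * t) (D / t) u * (trace (resolvent (C * t) u) * trace (radial A (C * t) u) + trace (resolvent (C * t) u) + C * t * trace (resolvent (C * t) u ** resolvent (C * t) u)))
     - D / t * (LINT u|M. integrand A B (C * t) (D / t) u * trace (resolvent (D / t) (adj u)) * trace (radial A (C * t) u))) / t"
      using t(5) by (simp add: diff_divide_distrib power2_eq_square)
    finally show ?thesis
      unfolding loop_first_deriv[OF assms(1,2) t(1,2)] casimir_moment[OF assms(1,2) t(1-4)] .
  qed
  ultimately show ?thesis by simp
qed

lemma radial_mean_quotient_invariant:
  assumes "norm A \<noteq> 1" "norm B \<noteq> 1" "open T" "convex T" "s \<in> T" "t \<in> T"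
    and T: "\<And>t. t \<in> T \<Longrightarrow> t \<noteq> 0 \<and> norm (C * t) < 1 \<and> norm (D / t) < 1 \<and> C * t \<noteq> A \<and> D / t \<noteq> B"
  shows "radial_mean A B (C * s) (D / s) / ((C * s - A) * (D / s - B)) = radial_mean A B (C * t) (D / t) / ((C * t - A) * (D / t - B))"
proof -
  define f where "f t = radial_mean A B (C * t) (D / t) / ((C * t - A) * (D / t - B))" for t
  have d: "(f has_field_derivative 0) (at t)" if "t \<in> T" for t
  proof -
    have t: "C * t - A \<noteq> 0" "D / t - B \<noteq> 0" "t \<noteq> 0" using T[OF that] by auto
    define k a b where "k = radial_mean A B (C * t) (D / t)" and "a = C * t - A" and "b = D / t - B"
    note ab = a_def[symmetric] b_def[symmetric] k_def[symmetric]
    have K: "((\<lambda>t. radial_mean A B (C * t) (D / t)) has_field_derivative (C * t / a - (D / t) / b) * k / t) (at t)"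
      using DERIV_radial_mean[OF assms(1,2,3) that T] unfolding ab by simp
    have E: "((\<lambda>t. (C * t - A) * (D / t - B)) has_field_derivative C * b - a * (D / t\<^sup>2)) (at t)"
    proof -
      have "((\<lambda>t. C * t - A) has_field_derivative C) (at t)"
        by (auto intro!: derivative_eq_intros)
      moreover have "((\<lambda>t. D / t - B) has_field_derivative - (D / t\<^sup>2)) (at t)"
        using t(3) by (auto intro!: derivative_eq_intros simp: power2_eq_square)
      ultimately show ?thesis
        unfolding a_def b_def by (rule DERIV_cong[OF DERIV_mult]) (simp add: mult.commute)
    qed
    have "(f has_field_derivative ((C * t / a - (D / t) / b) * k / t * (a * b) - k * (C * b - a * (D / t\<^sup>2))) / ((a * b) * (a * b))) (at t)"
      unfolding f_def using DERIV_divide[OF K E] t unfolding ab by simp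
    also have "(C * t / a - (D / t) / b) * k / t * (a * b) - k * (C * b - a * (D / t\<^sup>2)) = 0"
      using t unfolding ab by (simp add: field_simps power2_eq_square)
    finally show ?thesis by simp
  qed
  from has_field_derivative_zero_constant[OF assms(4) has_field_derivative_at_within[OF d]]
  have "\<exists>c. \<forall>t\<in>T. f t = c" by auto
  then have "f s = f t" using assms(5,6) by auto
  then show ?thesis unfolding f_def .
qed

end

section \<open>Evaluation of the average\<close>

lemma zero_derivative_off_0:
  fixes f :: "complex \<Rightarrow> complex"
  assumes "r > 1" "\<And>z. z \<in> ball 0 r \<Longrightarrow> (f has_field_derivative f' z) (at z)"
    and "\<And>z. z \<in> ball 0 r \<Longrightarrow> z * f' z = 0"
  shows "f 1 = f 0"
proof (rule has_derivative_zero_unique_strong_convex[of "ball 0 r" "{0}" f 0])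
  show "continuous_on (ball 0 r) f"
    using assms(2) by (intro continuous_at_imp_continuous_on ballI) (meson DERIV_isCont)
  show "(f has_derivative (\<lambda>h. 0)) (at z within ball 0 r)" if "z \<in> ball 0 r - {0}" for z
  proof -
    have "f' z = 0" using assms(3)[of z] that by auto
    then have "(f has_derivative (\<lambda>h. 0)) (at z)"
      using assms(2)[of z] that by (simp add: has_field_derivative_def lambda_zero)
    then show ?thesis by (rule has_derivative_at_withinI)
  qed
qed (use assms in auto)

text \<open>The right-hand side of the theorem, with the singularities at \<open>A * B \<in> {0, 1}\<close> removed.\<close>
definition ratio_poly :: "nat \<Rightarrow> complex \<Rightarrow> complex \<Rightarrow> complex \<Rightarrow> complex \<Rightarrow> complex" where
  "ratio_poly N A B C D =
     (1 - B * C) * (1 - A * D) * (\<Sum>k<N. (A * B) ^ k) / (1 - C * D) + (A * B) ^ N"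

lemma one_minus_mult_nonzero:
  assumes "norm (C :: complex) < 1" "norm D < 1"
  shows "1 - C * D \<noteq> 0"
proof -
  have "norm (C * D) < 1 * 1" unfolding norm_mult using assms by (intro mult_strict_mono') auto
  then show ?thesis by auto
qed

context haar
begin

text \<open>With \<open>A = C = 0\<close> the left side of \<open>loop_first\<close> vanishes, so the average is constant along the ray
  \<open>(z B, z D)\<close>, and it equals 1 at \<open>z = 0\<close>.\<close>
lemma expectation_one_sided_disc:
  assumes "norm B < 1" "norm D < 1"
  shows "ratio_mean 0 B 0 D = 1"
proof -
  define m where "m = max (norm B) (norm D)"
  obtain r where r: "1 < r" "\<And>z::complex. norm z < r \<Longrightarrow> norm z * m < 1"
  proof (cases "m = 0")
    case True
    then show ?thesis using that[of 2] by simp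
  next
    case False
    then have "m > 0" "m < 1" using assms unfolding m_def by (auto simp: max_def)
    then show ?thesis using that[of "1 / m"] by (simp add: field_simps)
  qed
  have bd: "norm (z * B) < 1" "norm (z * D) < 1" if "z \<in> ball 0 r" for z
  proof -
    have "norm z * norm B \<le> norm z * m" "norm z * norm D \<le> norm z * m"
      by (auto simp: m_def intro!: mult_left_mono)
    with r(2)[of z] that show "norm (z * B) < 1" "norm (z * D) < 1" by (auto simp: norm_mult)
  qed
  have nz: "rcharpoly (z * B) (adj u) \<noteq> 0" "rcharpoly (z * D) (adj u) \<noteq> 0" if "z \<in> ball 0 r" "u \<in> unitary_group" for z u
    using bd that rcharpoly_adj_nonzero by blast+
  define F' where "F' z u = integrand 0 (z * B) 0 (z * D) u * (D * trace (resolvent (z * D) (adj u)) - B * trace (resolvent (z * B) (adj u)))"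
    for z and u :: "complex^'n^'n"
  have "ratio_mean 0 (1 * B) 0 (1 * D) = ratio_mean 0 (0 * B) 0 (0 * D)"
  proof (rule zero_derivative_off_0[where r = r and f' = "\<lambda>z. LINT u|M. F' z u"])
    fix z :: complex assume z: "z \<in> ball 0 r"
    show "((\<lambda>z. ratio_mean 0 (z * B) 0 (z * D)) has_field_derivative (LINT u|M. F' z u)) (at z)"
    proof (rule DERIV_integral[where S = "ball 0 r"])
      show "continuous_on (ball 0 r \<times> unitary_group) (\<lambda>p. F' (fst p) (snd p))"
        unfolding F'_def integrand_def by (auto intro!: continuous_intros simp: nz)
      show "continuous_on unitary_group (integrand 0 (z * B) 0 (z * D))" if "z \<in> ball 0 r" for z
        using that unfolding integrand_def by (auto intro!: continuous_intros simp: nz)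
      show "((\<lambda>z. integrand 0 (z * B) 0 (z * D) u) has_field_derivative F' z u) (at z)"
        if "z \<in> ball 0 r" "u \<in> unitary_group" for z u
        unfolding integrand_def F'_def
        by (rule DERIV_cong[OF DERIV_cmult[OF DERIV_char_ratio_radial[OF nz[OF that]]]]) simp
    qed (use z in auto)
    have "z * (LINT u|M. F' z u) = (LINT u|M. integrand 0 (z * B) 0 (z * D) u * trace (radial (z * B) (z * D) (adj u)))"
      unfolding integral_mult_right_zero[symmetric] F'_def trace_radial
      by (rule integral_cong_M) (simp add: algebra_simps)
    also have "\<dots> = (LINT u|M. integrand 0 (z * B) 0 (z * D) u * trace (radial 0 0 u))"
      using bd[OF z] by (intro loop_first[symmetric]) auto
    also have "\<dots> = 0" by (simp add: trace_radial)
    finally show "z * (LINT u|M. F' z u) = 0" .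
  qed (use r in auto)
  then show ?thesis by (simp add: integrand_def char_ratio_def prob_space)
qed

lemma holomorphic_left:
  assumes "continuous_on unitary_group G"
  shows "(\<lambda>z. LINT u|M. rcharpoly z u * G u) holomorphic_on UNIV" "(\<lambda>z. LINT u|M. rcharpoly z (adj u) * G u) holomorphic_on UNIV"
proof -
  have snd: "continuous_on (UNIV \<times> unitary_group) (\<lambda>p. G (snd p))"
    by (rule continuous_on_compose2[OF assms continuous_on_snd[OF continuous_on_id]]) auto
  have "((\<lambda>z. LINT u|M. rcharpoly z (h u) * G u) has_field_derivative (LINT u|M. rcharpoly' z (h u) * G u)) (at z)"
    if h: "continuous_on unitary_group h" for z and h :: "complex^'n^'n \<Rightarrow> complex^'n^'n"
  proof (rule DERIV_integral[where S = UNIV])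
    have "continuous_on (UNIV \<times> unitary_group) (\<lambda>p. h (snd p))"
      by (rule continuous_on_compose2[OF h continuous_on_snd[OF continuous_on_id]]) auto
    then show "continuous_on (UNIV \<times> unitary_group) (\<lambda>p. rcharpoly' (fst p) (h (snd p)) * G (snd p))"
      by (intro continuous_intros snd)
    show "continuous_on unitary_group (\<lambda>u. rcharpoly z (h u) * G u)" for z
      by (intro continuous_intros assms h)
    show "((\<lambda>z. rcharpoly z (h u) * G u) has_field_derivative rcharpoly' z (h u) * G u) (at z)" for z u
      by (rule DERIV_cmult_right[OF DERIV_rcharpoly])
  qed auto
  from this[OF continuous_on_id] this[OF continuous_on_adj[OF continuous_on_id]]
  show "(\<lambda>z. LINT u|M. rcharpoly z u * G u) holomorphic_on UNIV" "(\<lambda>z. LINT u|M. rcharpoly z (adj u) * G u) holomorphic_on UNIV"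
    unfolding holomorphic_on_open[OF open_UNIV] by blast+
qed

lemma holomorphic_A:
  assumes "norm C < 1" "norm D < 1"
  shows "(\<lambda>A. ratio_mean A B C D) holomorphic_on UNIV"
proof -
  have "continuous_on unitary_group (\<lambda>u. char_ratio B D (adj u) / rcharpoly C u)"
    using rcharpoly_nonzero[OF assms(1)] rcharpoly_adj_nonzero[OF assms(2)] by (intro continuous_intros) auto
  moreover have "integrand A B C D = (\<lambda>u :: complex^'n^'n. rcharpoly A u * (char_ratio B D (adj u) / rcharpoly C u))" for A
    by (simp add: fun_eq_iff integrand_def char_ratio_def)
  ultimately show ?thesis using holomorphic_left(1) by (simp only:)
qed

lemma holomorphic_B:
  assumes "norm C < 1" "norm D < 1"
  shows "(\<lambda>B. ratio_mean A B C D) holomorphic_on UNIV"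
proof -
  have "continuous_on unitary_group (\<lambda>u. char_ratio A C u / rcharpoly D (adj u))"
    using rcharpoly_nonzero[OF assms(1)] rcharpoly_adj_nonzero[OF assms(2)] by (intro continuous_intros) auto
  moreover have "integrand A B C D = (\<lambda>u :: complex^'n^'n. rcharpoly B (adj u) * (char_ratio A C u / rcharpoly D (adj u)))" for B
    by (simp add: fun_eq_iff integrand_def char_ratio_def)
  ultimately show ?thesis using holomorphic_left(2) by (simp only:)
qed

lemma holomorphic_C:
  assumes "norm D < 1"
  shows "(\<lambda>C. ratio_mean A B C D) holomorphic_on ball 0 1"
proof -
  have nz: "\<And>z u. norm z < 1 \<Longrightarrow> u \<in> unitary_group \<Longrightarrow> rcharpoly z u \<noteq> 0" "\<And>u. u \<in> unitary_group \<Longrightarrow> rcharpoly D (adj u) \<noteq> 0"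
    using rcharpoly_nonzero rcharpoly_adj_nonzero[OF assms] by blast+
  have "((\<lambda>C. ratio_mean A B C D) has_field_derivative (LINT u|M. integrand A B C D u * trace (resolvent C u))) (at C)"
    if "C \<in> ball 0 1" for C
  proof (rule DERIV_integral[where S = "ball 0 1"])
    show "continuous_on (ball 0 1 \<times> unitary_group) (\<lambda>p. integrand A B (fst p) D (snd p) * trace (resolvent (fst p) (snd p)))"
      unfolding integrand_def by (auto intro!: continuous_intros simp: nz)
    show "continuous_on unitary_group (integrand A B z D)" if "z \<in> ball 0 1" for z
      using that unfolding integrand_def by (auto intro!: continuous_intros simp: nz)
    show "((\<lambda>z. integrand A B z D u) has_field_derivative integrand A B z D u * trace (resolvent z u)) (at z)"
      if "z \<in> ball 0 1" "u \<in> unitary_group" for z u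
    proof -
      have "rcharpoly z u \<noteq> 0" using that nz(1) by simp
      from DERIV_cmult_right[OF DERIV_char_ratio_right[OF this]] show ?thesis
        unfolding integrand_def by (rule DERIV_cong) (simp add: mult_ac)
    qed
  qed (use that in auto)
  then show ?thesis unfolding holomorphic_on_open[OF open_ball] by blast
qed

lemma expectation_one_sided:
  assumes "norm D < 1"
  shows "ratio_mean 0 B 0 D = 1"
  by (rule analytic_continuation_open[of "ball 0 1" UNIV "\<lambda>B. ratio_mean 0 B 0 D" "\<lambda>_. 1"])
    (use assms expectation_one_sided_disc holomorphic_B in auto)

text \<open>Applying \<open>rcharpoly_reciprocal\<close> to both \<open>A\<close> and \<open>c\<close> cancels \<open>det u\<close> as well as the factor at
  \<open>1 / c\<close>, and leaves a one-sided average with \<open>1 / A\<close> in place of \<open>B\<close>.\<close>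
lemma expectation_reciprocal:
  assumes "A \<noteq> 0" "c \<noteq> 0" "norm c < 1" "norm D < 1"
  shows "ratio_mean A (1 / c) c D = (A / c) ^ CARD('n)"
proof -
  have "ratio_mean A (1 / c) c D = (LINT u|M. (A / c) ^ CARD('n) * integrand 0 (1 / A) 0 D u)"
  proof (rule integral_cong_M)
    fix u :: "complex^'n^'n" assume u: "u \<in> unitary_group"
    have "det u \<noteq> 0"
      using u unfolding unitary_iff by (metis det_I det_mul mult_zero_left zero_neq_one)
    moreover have "rcharpoly (1 / c) (adj u) \<noteq> 0"
      using rcharpoly_reciprocal[OF u assms(2)] rcharpoly_nonzero[OF assms(3) u] by auto
    ultimately show "integrand A (1 / c) c D u = (A / c) ^ CARD('n) * integrand 0 (1 / A) 0 D u"
      unfolding integrand_def char_ratio_def rcharpoly_reciprocal[OF u assms(1)] rcharpoly_reciprocal[OF u assms(2)]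
      using assms by (simp add: power_divide power_minus[of A] power_minus[of c] field_simps)
  qed
  also have "\<dots> = (A / c) ^ CARD('n) * ratio_mean 0 (1 / A) 0 D"
    by (rule integral_mult_right_zero)
  finally show ?thesis by (simp add: expectation_one_sided[OF assms(4)])
qed

text \<open>Along \<open>(z A, z C)\<close> the numerator has derivative \<open>1 / z\<close> times the radial mean, so the difference of
  the two quotients has vanishing derivative by \<open>radial_mean_quotient_invariant\<close>; at \<open>z = 0\<close> both
  numerators vanish by \<open>expectation_one_sided\<close>.  The bounds on \<open>A\<close> and \<open>B\<close> keep all
  resolvents regular and all denominators away from 0 on the whole path.\<close>
lemma ratio_mean_quotient_invariant:
  assumes "norm A < 1" "A \<noteq> 0" "norm B > 1" "open T" "convex T" "s \<in> T" "t \<in> T"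
    and T: "\<And>t. t \<in> T \<Longrightarrow> t \<noteq> 0 \<and> norm (C * t) < norm A \<and> norm (D / t) < 1"
  shows "(ratio_mean A B (C * s) (D / s) - 1) / ((C * s - A) * (D / s - B)) = (ratio_mean A B (C * t) (D / t) - 1) / ((C * t - A) * (D / t - B))"
proof -
  define r where "r = 1 / norm A"
  have r: "r > 1" using assms by (simp add: r_def)
  have zA: "norm (z * A) < 1" if "z \<in> ball 0 r" for z
    using that assms by (simp add: r_def norm_mult field_simps)
  have zC: "norm (z * (C * t)) < 1" if "z \<in> ball 0 r" "t \<in> T" for z t
  proof -
    have "norm (z * (C * t)) = norm z * norm (C * t)" by (simp add: norm_mult)
    also have "\<dots> \<le> norm z * norm A" using T[OF that(2)] by (intro mult_left_mono) auto
    also have "\<dots> < 1" using zA[OF that(1)] by (simp add: norm_mult)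
    finally show ?thesis .
  qed
  have T': "t \<noteq> 0" "C * t \<noteq> A" "D / t \<noteq> B" "norm (D / t) < 1" if "t \<in> T" for t
    using T[OF that] assms(3) by auto
  have nz: "\<And>z u. z \<in> ball 0 r \<Longrightarrow> u \<in> unitary_group \<Longrightarrow> rcharpoly (z * A) u \<noteq> 0"
    "\<And>z t u. z \<in> ball 0 r \<Longrightarrow> t \<in> T \<Longrightarrow> u \<in> unitary_group \<Longrightarrow> rcharpoly (z * (C * t)) u \<noteq> 0"
    "\<And>t u. t \<in> T \<Longrightarrow> u \<in> unitary_group \<Longrightarrow> rcharpoly (D / t) (adj u) \<noteq> 0"
    using zA zC T'(4) rcharpoly_nonzero rcharpoly_adj_nonzero by blast+
  define g where "g t z = (ratio_mean (z * A) B (z * (C * t)) (D / t) - 1) / ((C * t - A) * (D / t - B))" for t z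
  define F' where "F' t z u = integrand (z * A) B (z * (C * t)) (D / t) u * (C * t * trace (resolvent (z * (C * t)) u) - A * trace (resolvent (z * A) u))"
    for t z and u :: "complex^'n^'n"
  define g' where "g' t z = (LINT u|M. F' t z u) / ((C * t - A) * (D / t - B))" for t z
  have deriv: "(g t has_field_derivative g' t z) (at z)" if z: "z \<in> ball 0 r" and t: "t \<in> T" for t z
  proof -
    have "((\<lambda>z. ratio_mean (z * A) B (z * (C * t)) (D / t)) has_field_derivative (LINT u|M. F' t z u)) (at z)"
    proof (rule DERIV_integral[where S = "ball 0 r"])
      show "continuous_on (ball 0 r \<times> unitary_group) (\<lambda>p. F' t (fst p) (snd p))"
        unfolding F'_def integrand_def using t by (auto intro!: continuous_intros simp: nz)
      show "continuous_on unitary_group (integrand (z * A) B (z * (C * t)) (D / t))" if "z \<in> ball 0 r" for z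
        using that t unfolding integrand_def by (auto intro!: continuous_intros simp: nz)
      show "((\<lambda>z. integrand (z * A) B (z * (C * t)) (D / t) u) has_field_derivative F' t z u) (at z)"
        if "z \<in> ball 0 r" "u \<in> unitary_group" for z u
        unfolding integrand_def F'_def
        by (rule DERIV_cong[OF DERIV_cmult_right[OF DERIV_char_ratio_radial[OF nz(1)[OF that] nz(2)[OF that(1) t that(2)]]]])
          simp
    qed (use z in auto)
    then show ?thesis
      unfolding g_def g'_def by (intro DERIV_cdivide) (auto intro!: derivative_eq_intros)
  qed
  have g'K: "g' t z = radial_mean (z * A) B (z * C * t) (D / t) / ((z * C * t - z * A) * (D / t - B))" if "z \<noteq> 0" for t z
  proof -
    have K: "z * (LINT u|M. F' t z u) = radial_mean (z * A) B (z * C * t) (D / t)"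
      unfolding integral_mult_right_zero[symmetric] F'_def trace_radial
      by (rule integral_cong_M) (simp add: algebra_simps)
    have den: "(z * C * t - z * A) * (D / t - B) = z * ((C * t - A) * (D / t - B))"
      by (simp add: algebra_simps)
    show ?thesis
      unfolding den K[symmetric] g'_def using that by simp
  qed
  have "g s 1 - g t 1 = g s 0 - g t 0"
  proof (rule zero_derivative_off_0[OF r])
    fix z :: complex assume z: "z \<in> ball 0 r"
    show "((\<lambda>z. g s z - g t z) has_field_derivative g' s z - g' t z) (at z)"
      using deriv z assms by (intro DERIV_diff) auto
    show "z * (g' s z - g' t z) = 0"
    proof (cases "z = 0")
      case False
      have "g' s z = g' t z"
        unfolding g'K[OF False]
      proof (rule radial_mean_quotient_invariant[OF _ _ assms(4-7)])
        show "norm (z * A) \<noteq> 1" "norm B \<noteq> 1" using zA[OF z] assms(3) by auto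
        show "t \<noteq> 0 \<and> norm (z * C * t) < 1 \<and> norm (D / t) < 1 \<and> z * C * t \<noteq> z * A \<and> D / t \<noteq> B" if "t \<in> T" for t
          using T'[OF that] zC[OF z that] False by (auto simp: mult.assoc)
      qed
      then show ?thesis by simp
    qed simp
  qed
  moreover have "g t 0 = 0" if "t \<in> T" for t
    using expectation_one_sided[OF T'(4)[OF that]] by (simp add: g_def)
  ultimately have "g s 1 = g t 1" using assms(6,7) by simp
  then show ?thesis by (simp add: g_def)
qed

text \<open>The last two hypotheses place \<open>1 / (B * C)\<close> in a convex region of admissible scalings \<open>t\<close>
  that contains 1; they hold for \<open>B\<close> near \<open>1 / C\<close>.\<close>
lemma expectation_generic:
  assumes "C \<noteq> 0" "norm C < norm A" "norm A < 1" "norm D < 1"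
    and B: "norm D * (norm (B * C))\<^sup>2 < Re (B * C)" "1 < norm (A * B)"
  shows "ratio_mean A B C D = ratio_poly CARD('n) A B C D"
proof -
  define T where "T = {t. norm D < Re t} \<inter> ball 0 (norm A / norm C)"
  define c d where "c = 1 / B" and "d = D * (B * C)"
  have A: "A \<noteq> 0" using assms by auto
  have BC: "B * C \<noteq> 0" using B(1) by auto
  then have "B \<noteq> 0" by auto
  have "norm (A * B) \<le> norm B" using assms(3) by (simp add: norm_mult mult_left_le_one_le)
  then have nB: "1 < norm B" using B(2) by linarith
  have T: "t \<noteq> 0 \<and> norm (C * t) < norm A \<and> norm (D / t) < 1" if "t \<in> T" for t
  proof -
    have "norm D < norm t" using that complex_Re_le_cmod[of t] by (auto simp: T_def)
    moreover from this have "t \<noteq> 0" by auto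
    ultimately show ?thesis using that assms(1)
      by (auto simp: T_def norm_mult norm_divide field_simps)
  qed
  have "Re (1 / (B * C)) = Re (B * C) / (norm (B * C))\<^sup>2"
    by (simp only: Re_divide norm_complex_def) (simp add: cmod_power2[unfolded norm_complex_def])
  then have "norm D < Re (1 / (B * C))"
    using B(1) BC by (simp only: less_divide_eq) simp
  moreover have "norm (1 / (B * C)) < norm A / norm C"
    using B(2) BC assms(1) by (auto simp: norm_mult norm_divide field_simps)
  ultimately have t: "1 / (B * C) \<in> T" by (simp add: T_def)
  have "1 \<in> T" using assms by (simp add: T_def)
  have "open T" "convex T"
    unfolding T_def by (auto intro!: open_Int convex_Int open_halfspace_Re_gt convex_halfspace_Re_gt)
  from ratio_mean_quotient_invariant[OF assms(3) A nB this \<open>1 \<in> T\<close> t T]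
  have "(ratio_mean A B C D - 1) / ((C - A) * (D - B)) = (ratio_mean A B c d - 1) / ((c - A) * (d - B))"
    using BC by (simp add: c_def d_def)
  moreover have "norm c < 1" "norm d < 1" "c \<noteq> 0"
    using T[OF t] assms BC nB by (auto simp: c_def d_def norm_divide)
  then have "ratio_mean A B c d = (A * B) ^ CARD('n)"
    using expectation_reciprocal[OF A, of c d] by (simp add: c_def)
  moreover have ne: "C - A \<noteq> 0" "D - B \<noteq> 0" "1 - A * B \<noteq> 0" "1 - C * D \<noteq> 0"
  proof -
    show "C - A \<noteq> 0" "D - B \<noteq> 0" using assms nB by auto
    show "1 - A * B \<noteq> 0" using B(2) by auto
    have "norm (C * D) < 1 * 1" unfolding norm_mult using assms by (intro mult_strict_mono') auto
    then show "1 - C * D \<noteq> 0" by auto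
  qed
  moreover have "(c - A) * (d - B) = - ((1 - A * B) * (1 - C * D))"
    using \<open>B \<noteq> 0\<close> by (simp add: c_def d_def field_simps)
  moreover have pow: "1 - (A * B) ^ CARD('n) = (1 - A * B) * (\<Sum>k<CARD('n). (A * B) ^ k)"
    by (rule one_diff_power_eq)
  ultimately have "ratio_mean A B C D = 1 + (C - A) * (D - B) * (\<Sum>k<CARD('n). (A * B) ^ k) / (1 - C * D)"
  proof -
    assume *: "(ratio_mean A B C D - 1) / ((C - A) * (D - B)) = (ratio_mean A B c d - 1) / ((c - A) * (d - B))"
      "ratio_mean A B c d = (A * B) ^ CARD('n)" "(c - A) * (d - B) = - ((1 - A * B) * (1 - C * D))"
    have "(ratio_mean A B C D - 1) / ((C - A) * (D - B)) = (1 - (A * B) ^ CARD('n)) / ((1 - A * B) * (1 - C * D))"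
      unfolding * by (simp add: minus_divide_right[symmetric] minus_divide_left)
    also have "\<dots> = (\<Sum>k<CARD('n). (A * B) ^ k) / (1 - C * D)"
      unfolding pow using ne by simp
    finally have "ratio_mean A B C D - 1 = (\<Sum>k<CARD('n). (A * B) ^ k) / (1 - C * D) * ((C - A) * (D - B))"
      using ne by (subst (asm) divide_eq_eq) simp
    then show ?thesis by (simp add: algebra_simps)
  qed
  also have "\<dots> = ratio_poly CARD('n) A B C D"
  proof -
    define S where "S = (\<Sum>k<CARD('n). (A * B) ^ k)"
    have q: "(A * B) ^ CARD('n) = 1 - (1 - A * B) * S" using pow unfolding S_def by (simp add: algebra_simps)
    show ?thesis unfolding ratio_poly_def S_def[symmetric] q using ne(4)
      by (simp add: field_simps)
  qed
  finally show ?thesis .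
qed

text \<open>Holomorphy in one parameter at a time removes the restrictions of \<open>expectation_generic\<close>: in \<open>B\<close>
  from a neighbourhood of \<open>1 / C\<close>, in \<open>A\<close> from an annulus, in \<open>C\<close> from the punctured disc.\<close>
lemma expectation_ratio:
  assumes "norm C < 1" "norm D < 1"
  shows "ratio_mean A B C D = ratio_poly CARD('n) A B C D"
proof -
  have 1: "ratio_mean A B C D = ratio_poly CARD('n) A B C D"
    if "C \<noteq> 0" "norm C < norm A" "norm A < 1" for A B C
  proof (rule analytic_continuation_open[where f = "\<lambda>B. ratio_mean A B C D" and g = "\<lambda>B. ratio_poly CARD('n) A B C D" and s' = UNIV])
    let ?U = "{B. norm D * (norm (B * C))\<^sup>2 < Re (B * C)} \<inter> {B. 1 < norm (A * B)}"
    show "open ?U" by (intro open_Int open_Collect_less continuous_intros)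
    have "1 / C * C = 1" using that by simp
    then have "1 / C \<in> ?U"
      using that assms by (simp only: Int_iff mem_Collect_eq) (simp add: norm_divide)
    then show "?U \<noteq> {}" by blast
    show "(\<lambda>B. ratio_mean A B C D) holomorphic_on UNIV" using that assms by (intro holomorphic_B) auto
    show "(\<lambda>B. ratio_poly CARD('n) A B C D) holomorphic_on UNIV"
      unfolding ratio_poly_def using that assms one_minus_mult_nonzero[of C D] by (intro holomorphic_intros) auto
    show "ratio_mean A B C D = ratio_poly CARD('n) A B C D" if "B \<in> ?U" for B
      using that \<open>C \<noteq> 0\<close> \<open>norm C < norm A\<close> \<open>norm A < 1\<close> assms(2) by (intro expectation_generic) auto
  qed auto
  have 2: "ratio_mean A B C D = ratio_poly CARD('n) A B C D" if "C \<noteq> 0" "norm C < 1" for A B C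
  proof (rule analytic_continuation_open[where f = "\<lambda>A. ratio_mean A B C D" and g = "\<lambda>A. ratio_poly CARD('n) A B C D" and s' = UNIV])
    let ?U = "{A::complex. norm C < norm A} \<inter> {A. norm A < 1}"
    show "open ?U" by (intro open_Int open_Collect_less continuous_intros)
    obtain x where "norm C < x" "x < 1" using \<open>norm C < 1\<close> dense by blast
    moreover from this have "0 < x" using norm_ge_zero[of C] by linarith
    ultimately have "of_real x \<in> ?U" by simp
    then show "?U \<noteq> {}" by blast
    show "(\<lambda>A. ratio_mean A B C D) holomorphic_on UNIV" using that assms by (intro holomorphic_A) auto
    show "(\<lambda>A. ratio_poly CARD('n) A B C D) holomorphic_on UNIV"
      unfolding ratio_poly_def using that assms one_minus_mult_nonzero[of C D] by (intro holomorphic_intros) auto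
    show "ratio_mean A B C D = ratio_poly CARD('n) A B C D" if "A \<in> ?U" for A
      using that \<open>C \<noteq> 0\<close> by (intro 1) auto
  qed auto
  show ?thesis
  proof (rule analytic_continuation_open[where f = "\<lambda>C. ratio_mean A B C D" and g = "\<lambda>C. ratio_poly CARD('n) A B C D" and s' = "ball 0 1"])
    let ?U = "ball 0 1 - {0::complex}"
    show "open ?U" by auto
    have "1 / 2 \<in> ?U" by (simp add: norm_divide)
    then show "?U \<noteq> {}" by blast
    show "(\<lambda>C. ratio_mean A B C D) holomorphic_on ball 0 1" using assms by (intro holomorphic_C) auto
    show "(\<lambda>C. ratio_poly CARD('n) A B C D) holomorphic_on ball 0 1"
      unfolding ratio_poly_def using assms one_minus_mult_nonzero[of _ D] by (intro holomorphic_intros) auto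
    show "ratio_mean A B C D = ratio_poly CARD('n) A B C D" if "C \<in> ?U" for C
      using that by (intro 2) auto
  qed (use assms in auto)
qed

end

lemma ratio_rhs_eq_ratio_poly:
  assumes "C * D \<noteq> 1"
  shows "ratio_rhs N A B C D = ratio_poly N A B C D"
proof -
  let ?R = "\<lambda>p. ratio_poly N (fst p) (snd p) C D"
  have "is_ratio_rhs_extension N C D ?R"
    unfolding is_ratio_rhs_extension_def ratio_poly_def
    using assms by (auto intro!: continuous_intros simp: ratio_rhs_generic_eq)
  then have "(THE R. is_ratio_rhs_extension N C D R) = ?R"
    by (rule the1_equality[OF ratio_rhs_ex1[OF assms]])
  then show ?thesis by (simp add: ratio_rhs_def)
qed

theorem theoremA1:
  fixes A B C D :: complex and M :: "(complex^'n^'n) measure"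
  assumes "norm C < 1" and "norm D < 1"
    and "haar_probability M"
  shows "(LINT u|M.
            (det (mat 1 - map_matrix ((*) A) u) * det (mat 1 - map_matrix ((*) B) (matrix_inv u))) /
            (det (mat 1 - map_matrix ((*) C) u) * det (mat 1 - map_matrix ((*) D) (matrix_inv u))))
         = ratio_rhs CARD('n) A B C D"
proof -
  interpret haar M by unfold_locales (rule assms)
  have "(LINT u|M.
            (det (mat 1 - map_matrix ((*) A) u) * det (mat 1 - map_matrix ((*) B) (matrix_inv u))) /
            (det (mat 1 - map_matrix ((*) C) u) * det (mat 1 - map_matrix ((*) D) (matrix_inv u))))
     = (LINT u|M. integrand A B C D u)"
    by (rule integral_cong_M) (simp add: integrand_def char_ratio_def rcharpoly_def unitary_matrix_inv)
  also have "\<dots> = ratio_poly CARD('n) A B C D"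
    by (rule expectation_ratio[OF assms(1,2)])
  also have "\<dots> = ratio_rhs CARD('n) A B C D"
    using one_minus_mult_nonzero[OF assms(1,2)] by (intro ratio_rhs_eq_ratio_poly[symmetric]) auto
  finally show ?thesis .
qed

end
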